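(* Let $d\in\mathbb{N}$. For each fixed $n\in\mathbb{N}$ and $x\in S^{d}$, let $\Gamma_{n,x}=\{\mu_{n,\alpha,x}\}_{|\alpha|=n}$ be a family of bounded, monotone, submodular and strictly positive set functions on $\mathcal{B}_{S^{d}}$, and let $M_{n,\Gamma_{n,x}}$ be the associated Bernstein-Durrmeyer-Choquet operator $$M_{n,\Gamma_{n,x}}(f)(x)=\sum_{|\alpha|=n}\frac{(C)\int_{S^{d}}f(t)P_{\alpha}(t)\,d\mu_{n,\alpha,x}(t)}{(C)\int_{S^{d}}P_{\alpha}(t)\,d\mu_{n,\alpha,x}(t)}\,B_{\alpha}(x).$$ (i) For every $f\in C_{+}(S^{d})$, $x=(x_1,\dots,x_d)\in S^{d}$ and $n\in\mathbb{N}$, $$|M_{n,\Gamma_{n,x}}(f)(x)-f(x)|\le 2\,\omega_{1}\bigl(f;M_{n,\Gamma_{n,x}}(\varphi_{x})(x)\bigr)_{S^{d}},$$ where $\|x\|=\sqrt{\sum_{i=1}^{d}x_i^{2}}$, $\varphi_{x}(t)=\|t-x\|$ and $\omega_{1}(f;\delta)_{S^{d}}=\sup\{|f(t)-f(y)| : t,y\in S^{d},\ \|t-y\|\le\delta\}$. (ii) Suppose that the family $\Gamma_{n,x}$ does not depend on $x$, and write $\Gamma_n$ for it. Then, for any $f\in C_{+}(S^{d})$ and $n\in\mathbb{N}$, $$\|M_{n,\Gamma_{n}}(f)-f\|_{C(S^{d})}\le 2K\left(f;\frac{\Delta_{n}}{2}\right),$$ where $\Delta_{n}=\sum_{i=1}^{d}\|M_{n,\Gamma_{n}}(|\varphi_{e_i}-x_i\mathbf{1}|)\|_{C(S^{d})}$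 (the norm being that of the function $x\mapsto M_{n,\Gamma_n}(|\varphi_{e_i}-x_i\mathbf{1}|)(x)$), with $\varphi_{e_i}(t)=t_i$ for $t=(t_1,\dots,t_d)\in S^d$ and $\mathbf{1}(t)=1$ for all $t\in S^{d}$, and $$K(f;t)=\inf_{g\in C^{1}_{+}(S^{d})}\{\|f-g\|_{C(S^{d})}+t\,\|\nabla g\|_{C(S^{d})}\},\qquad \|\nabla g\|_{C(S^{d})}=\max_{i\in\{1,\dots,d\}}\|\partial_i g\|_{C(S^{d})}.$$
   Context: $S^{d}=\{(x_1,\dots,x_d): 0\le x_1,\dots,x_d\le 1,\ 0\le x_1+\dots+x_d\le 1\}$ is the standard simplex and $\mathcal{B}_{S^{d}}$ is the $\sigma$-algebra of its Borel subsets. For a multi-index $\alpha=(\alpha_0,\alpha_1,\dots,\alpha_d)$ of nonnegative integers, $|\alpha|=\alpha_0+\dots+\alpha_d$; for $|\alpha|=n$, $P_{\alpha}(x)=(1-x_1-\dots-x_d)^{\alpha_0}x_1^{\alpha_1}\cdots x_d^{\alpha_d}$ and $B_{\alpha}(x)=\frac{n!}{\alpha_0!\alpha_1!\cdots\alpha_d!}P_{\alpha}(x)$. A set function $\mu:\mathcal{B}_{S^{d}}\to[0,+\infty]$ is monotone if $\mu(\emptyset)=0$ and $\mu(A)\le\mu(B)$ whenever $A\subset B$; submodular if $\mu(A\cup B)+\mu(A\cap B)\le\mu(A)+\mu(B)$ for all $A,B\in\mathcal{B}_{S^{d}}$; bounded if $\mu(S^{d})<+\infty$; strictly positive if $\mu(A\cap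 S^{d})>0$ for every open set $A\subset\mathbb{R}^{d}$ with $A\cap S^{d}\ne\emptyset$. For a monotone set function $\mu$ and a nonnegative Borel measurable $f$ on $S^{d}$, the Choquet integral is $(C)\int_{S^{d}}f\,d\mu=\int_{0}^{+\infty}\mu(\{\omega\in S^{d}: f(\omega)\ge\beta\})\,d\beta$. $C_{+}(S^{d})$ is the set of continuous functions $f:S^{d}\to\mathbb{R}_{+}=[0,+\infty)$, $\|F\|_{C(S^{d})}=\sup\{|F(x)|:x\in S^{d}\}$, and $C^{1}_{+}(S^{d})$ is the set of all $g\in C_{+}(S^{d})$ with continuous partial derivatives $\partial_i g$, $i\in\{1,\dots,d\}$. When $\Gamma_{n,x}$ does not depend on $x$, its elements are written $\mu_{n,\alpha}$ and $M_{n,\Gamma_n}(f)$ is the function $x\mapsto M_{n,\Gamma_n}(f)(x)$. *)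

theory Defs
  imports "HOL-Analysis.Analysis"
begin

text \<open>
  \<open>\<real>\<^sup>d\<close> is \<open>real ^ 'd\<close> for an arbitrary finite index type \<open>'d\<close>, so \<open>d = CARD('d) \<ge> 1\<close>.
  Functions on the simplex are total functions on \<open>real ^ 'd\<close>; no definition below depends on
  their values outside the simplex.
\<close>

definition std_simplex :: "(real ^ 'd) set" where
  "std_simplex = {x. (\<forall>i. 0 \<le> x $ i \<and> x $ i \<le> 1) \<and> 0 \<le> (\<Sum>i\<in>UNIV. x $ i) \<and> (\<Sum>i\<in>UNIV. x $ i) \<le> 1}"

definition simplex_borel :: "(real ^ 'd) set set" where
  "simplex_borel = sets (restrict_space borel std_simplex)"


subsection \<open>Multi-indices and Bernstein polynomials\<close>

text \<open>
  A multi-index \<open>(\<alpha>\<^sub>0, \<alpha>\<^sub>1, \<dots>, \<alpha>\<^sub>d)\<close> is a function on \<open>'d option\<close>: \<open>None\<close> carries \<open>\<alpha>\<^sub>0\<close>,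
  \<open>Some i\<close> carries the exponent of the coordinate \<open>x $ i\<close>.
\<close>

definition mi_size :: "('d::finite option \<Rightarrow> nat) \<Rightarrow> nat" where
  "mi_size \<alpha> = (\<Sum>j\<in>UNIV. \<alpha> j)"

definition bern_P :: "('d::finite option \<Rightarrow> nat) \<Rightarrow> real ^ 'd \<Rightarrow> real" where
  "bern_P \<alpha> x = (1 - (\<Sum>i\<in>UNIV. x $ i)) ^ \<alpha> None * (\<Prod>i\<in>UNIV. (x $ i) ^ \<alpha> (Some i))"

definition bern_B :: "('d::finite option \<Rightarrow> nat) \<Rightarrow> real ^ 'd \<Rightarrow> real" where
  "bern_B \<alpha> x = fact (mi_size \<alpha>) / (\<Prod>j\<in>UNIV. fact (\<alpha> j)) * bern_P \<alpha> x"

lemma finite_mi_size: "finite {\<alpha> :: 'd::finite option \<Rightarrow> nat. mi_size \<alpha> = n}"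
proof (rule finite_subset)
  show "{\<alpha> :: 'd option \<Rightarrow> nat. mi_size \<alpha> = n} \<subseteq> (\<Pi>\<^sub>E j\<in>UNIV. {..n})"
  proof (clarsimp simp: PiE_def mi_size_def)
    fix \<alpha> :: "'d option \<Rightarrow> nat" and j
    show "\<alpha> j \<le> (\<Sum>j\<in>UNIV. \<alpha> j)"
      by (rule member_le_sum) auto
  qed
  show "finite (\<Pi>\<^sub>E j\<in>(UNIV :: 'd option set). {..n})"
    by (rule finite_PiE) simp_all
qed


subsection \<open>Set functions and the Choquet integral\<close>

text \<open>A set function is total on sets; only its values on \<^const>\<open>simplex_borel\<close> matter.\<close>

definition monotone_sf :: "((real ^ 'd) set \<Rightarrow> ennreal) \<Rightarrow> bool" where
  "monotone_sf \<mu> \<longleftrightarrow> \<mu> {} = 0 \<and> mono_on simplex_borel \<mu>"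

definition submodular_sf :: "((real ^ 'd) set \<Rightarrow> ennreal) \<Rightarrow> bool" where
  "submodular_sf \<mu> \<longleftrightarrow>
    (\<forall>A\<in>simplex_borel. \<forall>B\<in>simplex_borel. \<mu> (A \<union> B) + \<mu> (A \<inter> B) \<le> \<mu> A + \<mu> B)"

definition bounded_sf :: "((real ^ 'd) set \<Rightarrow> ennreal) \<Rightarrow> bool" where
  "bounded_sf \<mu> \<longleftrightarrow> \<mu> std_simplex < \<infinity>"

definition strictly_positive_sf :: "((real ^ 'd) set \<Rightarrow> ennreal) \<Rightarrow> bool" where
  "strictly_positive_sf \<mu> \<longleftrightarrow>
    (\<forall>A. open A \<longrightarrow> A \<inter> std_simplex \<noteq> {} \<longrightarrow> 0 < \<mu> (A \<inter> std_simplex))"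

definition choquet_integral :: "((real ^ 'd) set \<Rightarrow> ennreal) \<Rightarrow> (real ^ 'd \<Rightarrow> real) \<Rightarrow> ennreal" where
  "choquet_integral \<mu> f = (\<integral>\<^sup>+\<beta>\<in>{0..}. \<mu> {\<omega>\<in>std_simplex. f \<omega> \<ge> \<beta>} \<partial>lborel)"


subsection \<open>The Bernstein-Durrmeyer-Choquet operator\<close>

text \<open>
  \<open>BDC_op n \<Gamma> f x\<close> is \<open>M\<^sub>n\<^sub>,\<^sub>\<Gamma>(f)(x)\<close> for one family \<open>\<Gamma> = (\<mu>\<^sub>\<alpha>)\<close>; an \<open>x\<close>-dependent family is
  passed as \<open>BDC_op n (\<Gamma> n x) f x\<close>. For bounded monotone strictly positive set functions and
  continuous nonnegative \<open>f\<close> both integrals are finite and the denominator is nonzero, so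
  \<^const>\<open>enn2real\<close> loses nothing.
\<close>

definition BDC_op ::
  "nat \<Rightarrow> (('d::finite option \<Rightarrow> nat) \<Rightarrow> (real ^ 'd) set \<Rightarrow> ennreal) \<Rightarrow> (real ^ 'd \<Rightarrow> real) \<Rightarrow> real ^ 'd \<Rightarrow> real"
where
  "BDC_op n \<Gamma> f x =
    (\<Sum>\<alpha> | mi_size \<alpha> = n.
       enn2real (choquet_integral (\<Gamma> \<alpha>) (\<lambda>t. f t * bern_P \<alpha> t))
         / enn2real (choquet_integral (\<Gamma> \<alpha>) (bern_P \<alpha>)) * bern_B \<alpha> x)"


subsection \<open>Function spaces, moduli and the K-functional\<close>

definition C_plus :: "(real ^ 'd \<Rightarrow> real) set" where
  "C_plus = {f. continuous_on std_simplex f \<and> (\<forall>x\<in>std_simplex. 0 \<le> f x)}"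

definition sup_norm :: "(real ^ 'd \<Rightarrow> real) \<Rightarrow> real" where
  "sup_norm F = (SUP x\<in>std_simplex. \<bar>F x\<bar>)"

definition modulus_cont :: "(real ^ 'd \<Rightarrow> real) \<Rightarrow> real \<Rightarrow> real" where
  "modulus_cont f \<delta> = Sup {\<bar>f t - f y\<bar> | t y. t \<in> std_simplex \<and> y \<in> std_simplex \<and> norm (t - y) \<le> \<delta>}"

text \<open>
  At a boundary point such as a vertex, a line parallel to a coordinate axis may meet the simplex
  in that point only, so a partial derivative cannot be taken there inside the simplex.
  As usual for \<open>C\<^sup>1\<close> on a closed domain, \<open>\<partial>\<^sub>i g\<close> is the continuous function on the simplex
  that is the \<open>i\<close>-th partial derivative of \<open>g\<close> at interior points.
\<close>

definition has_cont_partial :: "'d \<Rightarrow> (real ^ 'd \<Rightarrow> real) \<Rightarrow> (real ^ 'd \<Rightarrow> real) \<Rightarrow> bool" where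
  "has_cont_partial i g D \<longleftrightarrow>
    continuous_on std_simplex D \<and>
    (\<forall>x\<in>interior std_simplex. ((\<lambda>h. g (x + h *\<^sub>R axis i 1)) has_real_derivative D x) (at 0))"

definition partial :: "'d \<Rightarrow> (real ^ 'd \<Rightarrow> real) \<Rightarrow> (real ^ 'd \<Rightarrow> real)" where
  "partial i g = (SOME D. has_cont_partial i g D)"

definition C1_plus :: "(real ^ 'd \<Rightarrow> real) set" where
  "C1_plus = {g \<in> C_plus. \<forall>i. \<exists>D. has_cont_partial i g D}"

definition grad_norm :: "(real ^ 'd \<Rightarrow> real) \<Rightarrow> real" where
  "grad_norm g = Max (range (\<lambda>i. sup_norm (partial i g)))"

definition K_functional :: "(real ^ 'd \<Rightarrow> real) \<Rightarrow> real \<Rightarrow> real" where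
  "K_functional f t = (INF g\<in>C1_plus. sup_norm (\<lambda>x. f x - g x) + t * grad_norm g)"

lemma interior_std_simplex_nonempty: "interior (std_simplex :: (real ^ 'd) set) \<noteq> {}"
proof -
  let ?N = "real CARD('d) + 1"
  let ?U = "(\<Inter>i. {x :: real ^ 'd. 0 < x $ i}) \<inter> {x. (\<Sum>i\<in>UNIV. x $ i) < 1}"
  have "open ?U"
    by (intro open_Int open_INT open_Collect_less ballI continuous_intros finite)
  moreover have "(\<chi> i. 1 / ?N) \<in> ?U"
    by (auto simp: field_simps)
  moreover have "?U \<subseteq> std_simplex"
  proof
    fix x assume x: "x \<in> ?U"
    then have nonneg: "0 \<le> x $ i" for i
      by (simp add: less_imp_le)
    have "x $ j \<le> (\<Sum>i\<in>UNIV. x $ i)" for j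
      using nonneg by (intro member_le_sum) auto
    moreover have "(\<Sum>i\<in>UNIV. x $ i) < 1"
      using x by simp
    ultimately have "x $ j \<le> 1" for j
      by (meson less_le_not_le order_trans)
    then show "x \<in> std_simplex"
      using nonneg \<open>(\<Sum>i\<in>UNIV. x $ i) < 1\<close> by (simp add: std_simplex_def sum_nonneg)
  qed
  ultimately have "(\<chi> i. 1 / ?N) \<in> interior (std_simplex :: (real ^ 'd) set)"
    by (rule interiorI)
  then show ?thesis
    by blast
qed

lemma convex_std_simplex: "convex (std_simplex :: (real ^ 'd) set)"
proof -
  have eq: "std_simplex = (\<Inter>i. {x :: real ^ 'd. 0 \<le> x $ i}) \<inter> {x. (\<Sum>i\<in>UNIV. x $ i) \<le> 1}"
  proof (intro equalityI subsetI)
    fix x :: "real ^ 'd"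
    assume x: "x \<in> (\<Inter>i. {x. 0 \<le> x $ i}) \<inter> {x. (\<Sum>i\<in>UNIV. x $ i) \<le> 1}"
    have "x $ j \<le> (\<Sum>i\<in>UNIV. x $ i)" for j
      using x by (intro member_le_sum) auto
    moreover have "(\<Sum>i\<in>UNIV. x $ i) \<le> 1"
      using x by simp
    ultimately have "x $ j \<le> 1" for j
      by (meson order_trans)
    then show "x \<in> std_simplex"
      using x by (simp add: std_simplex_def sum_nonneg)
  qed (auto simp: std_simplex_def)
  have "convex {x :: real ^ 'd. (\<Sum>i\<in>UNIV. x $ i) \<le> 1}"
    unfolding convex_def
    by (auto simp: sum.distrib simp flip: sum_distrib_left intro: convex_bound_le)
  moreover have "convex {x :: real ^ 'd. 0 \<le> x $ i}" for i
    by (auto simp: convex_def)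
  ultimately show ?thesis
    unfolding eq by (intro convex_Int convex_INT) auto
qed

text \<open>The continuous function in \<^const>\<open>partial\<close> is unique on the simplex.\<close>

lemma has_cont_partial_unique:
  assumes D: "has_cont_partial i g D" and D': "has_cont_partial i g D'" and x: "x \<in> std_simplex"
  shows "D x = D' x"
proof -
  have clo: "std_simplex \<subseteq> closure (interior std_simplex :: (real ^ 'd) set)"
    by (metis convex_closure_interior convex_std_simplex interior_std_simplex_nonempty closure_subset)
  then have "x \<in> closure (interior std_simplex)"
    using x by blast
  then obtain s where s: "\<And>n. s n \<in> interior std_simplex" "s \<longlonglongrightarrow> x"
    unfolding closure_sequential by blast
  have s': "\<And>n. s n \<in> std_simplex"
    using s(1) interior_subset by blast
  have "(\<lambda>n. D (s n)) \<longlonglongrightarrow> D x" "(\<lambda>n. D' (s n)) \<longlonglongrightarrow> D' x"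
    using D D' s(2) s' x
    by (auto simp: has_cont_partial_def continuous_on_sequentially o_def)
  moreover have "D (s n) = D' (s n)" for n
    using D D' s(1) by (meson DERIV_unique has_cont_partial_def)
  ultimately show ?thesis
    using LIMSEQ_unique by simp
qed

lemma partial_eqI:
  assumes "has_cont_partial i g D" "x \<in> std_simplex"
  shows "partial i g x = D x"
proof -
  have "has_cont_partial i g (partial i g)"
    unfolding partial_def by (rule someI[of "has_cont_partial i g", OF assms(1)])
  then show ?thesis
    using assms by (rule has_cont_partial_unique)
qed

end

theory Submission
  imports Defs
begin

text \<open>
  Fix \<open>n\<close> and one family of set functions and write \<open>T f = M\<^sub>n(f)(x)\<close>. The whole proof rests on
  \<open>T\<close> being a monotone, positively homogeneous and subadditive functional on nonnegative continuous
  functions with \<open>T 1 = 1\<close>. Such a functional, though not additive in general, still turns a pointwise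
  estimate \<open>\<bar>f(t) - f(x)\<bar> \<le> h(t)\<close> into \<open>\<bar>T f - f(x)\<bar> \<le> T h\<close>, because both \<open>f \<le> f(x) + h\<close> and
  \<open>f(x) \<le> f + h\<close> can be fed to it (\<open>BDC_op_deviation_le\<close>). Both parts are instances.

  For (i), take \<open>\<delta> = T \<phi>\<^sub>x\<close>, which is positive by strict positivity. Walking from \<open>x\<close> to \<open>t\<close> in
  steps of length at most \<open>\<delta>\<close> gives \<open>h(t) = (1 + \<phi>\<^sub>x(t) / \<delta>) \<omega>\<^sub>1(f; \<delta>)\<close>, and \<open>T h \<le> 2 \<omega>\<^sub>1(f; \<delta>)\<close>.

  For (ii), compare \<open>f\<close> with \<open>g \<in> C\<^sup>1\<^sub>+\<close>: the mean value theorem along coordinate directions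
  (\<open>abs_diff_le_partial_bounds\<close>) gives \<open>h(t) = 2 \<parallel>f - g\<parallel> + \<parallel>\<nabla>g\<parallel> \<Sum>\<^sub>i \<bar>t\<^sub>i - x\<^sub>i\<bar>\<close>, hence
  \<open>\<bar>T f - f(x)\<bar> \<le> 2 (\<parallel>f - g\<parallel> + (\<Delta>\<^sub>n / 2) \<parallel>\<nabla>g\<parallel>)\<close>, and one takes the infimum over \<open>g\<close>.

  Of the properties of \<open>T\<close>, the normalisation \<open>T 1 = 1\<close> is the multinomial theorem, and the hard
  part is subadditivity, that is, the subadditivity of the Choquet integral for a submodular set
  function (\<open>choquet_integral_add_le\<close>). For functions with values in the natural numbers the
  integral is \<open>\<Sum>\<^sub>k \<mu>(f \<ge> k + 1)\<close>; adding the indicator of one set increases it by at most the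
  value of that set, since the submodular inequalities on consecutive levels telescope, and a
  general summand is a sum of indicators of its own level sets. The real case follows by
  rounding to multiples of \<open>e > 0\<close>, at a cost of \<open>2 e \<mu>(S)\<close>.
\<close>

section \<open>The simplex and its continuous functions\<close>

lemma std_simplex_eq:
  "std_simplex = {x :: real ^ 'd. (\<forall>i. 0 \<le> x $ i) \<and> (\<Sum>i\<in>UNIV. x $ i) \<le> 1}"
proof -
  have "x $ j \<le> 1" if "\<forall>i. 0 \<le> x $ i" "(\<Sum>i\<in>UNIV. x $ i) \<le> 1" for x :: "real ^ 'd" and j
    using member_le_sum[of j UNIV "\<lambda>i. x $ i"] that by fastforce
  then show ?thesis
    by (auto simp: std_simplex_def sum_nonneg)
qed

lemma compact_std_simplex: "compact (std_simplex :: (real ^ 'd) set)"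
proof -
  have "closed (std_simplex :: (real ^ 'd) set)"
    unfolding std_simplex_eq
    by (intro closed_Collect_conj closed_Collect_all closed_Collect_le continuous_intros)
  moreover have "std_simplex \<subseteq> cbox 0 (1 :: real ^ 'd)"
    by (auto simp: std_simplex_def mem_box_cart)
  ultimately show ?thesis
    by (meson bounded_cbox bounded_subset compact_eq_bounded_closed)
qed

lemma interior_std_simplexD:
  assumes "x \<in> interior (std_simplex :: (real ^ 'd) set)"
  shows "0 < x $ i" and "(\<Sum>i\<in>UNIV. x $ i) < 1"
proof -
  obtain e where e: "e > 0" "cball x e \<subseteq> std_simplex"
    using assms mem_interior_cball by blast
  have mem: "x - e *\<^sub>R axis i 1 \<in> std_simplex" "x + e *\<^sub>R axis i 1 \<in> std_simplex" for i
    using e by (auto intro!: subsetD[OF e(2)] simp: dist_norm)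
  have "0 \<le> (x - e *\<^sub>R axis i 1) $ i"
    using mem(1) by (simp only: std_simplex_eq mem_Collect_eq)
  then show "0 < x $ i"
    using e by (simp add: axis_def)
  have "(\<Sum>j\<in>UNIV. (x + e *\<^sub>R axis undefined 1) $ j) \<le> 1"
    using mem(2) by (simp only: std_simplex_eq mem_Collect_eq)
  then show "(\<Sum>i\<in>UNIV. x $ i) < 1"
    using e by (simp add: sum.distrib axis_def flip: sum_distrib_left)
qed

lemma bern_P_nonneg: "x \<in> std_simplex \<Longrightarrow> 0 \<le> bern_P \<alpha> x"
  by (auto simp: bern_P_def std_simplex_def intro!: mult_nonneg_nonneg prod_nonneg)

lemma bern_P_pos: "x \<in> interior std_simplex \<Longrightarrow> 0 < bern_P \<alpha> x"
  using interior_std_simplexD[of x] by (auto simp: bern_P_def intro!: mult_pos_pos prod_pos)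

lemma bern_B_nonneg: "x \<in> std_simplex \<Longrightarrow> 0 \<le> bern_B \<alpha> x"
  by (simp add: bern_B_def bern_P_nonneg prod_nonneg)

lemma continuous_on_bern_P: "continuous_on A (bern_P \<alpha>)"
  unfolding bern_P_def by (intro continuous_intros)

lemma bern_P_C_plus: "bern_P \<alpha> \<in> C_plus"
  by (simp add: C_plus_def bern_P_nonneg continuous_on_bern_P)

lemma C_plus_add: "f \<in> C_plus \<Longrightarrow> g \<in> C_plus \<Longrightarrow> (\<lambda>t. f t + g t) \<in> C_plus"
  by (auto simp: C_plus_def intro!: continuous_intros)

lemma C_plus_mult: "f \<in> C_plus \<Longrightarrow> g \<in> C_plus \<Longrightarrow> (\<lambda>t. f t * g t) \<in> C_plus"
  by (auto simp: C_plus_def intro!: continuous_intros)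

lemma C_plus_const: "0 \<le> c \<Longrightarrow> (\<lambda>t. c) \<in> C_plus"
  by (auto simp: C_plus_def)

lemma C_plus_sum: "(\<And>i. i \<in> I \<Longrightarrow> f i \<in> C_plus) \<Longrightarrow> (\<lambda>t. \<Sum>i\<in>I. f i t) \<in> C_plus"
  by (auto simp: C_plus_def intro!: continuous_intros sum_nonneg)

lemma continuous_on_std_simplex_bounded:
  fixes f :: "real ^ 'd \<Rightarrow> real"
  assumes "continuous_on std_simplex f"
  obtains B where "0 < B" "\<And>x. x \<in> std_simplex \<Longrightarrow> \<bar>f x\<bar> \<le> B"
proof -
  have "bounded (f ` std_simplex)"
    using assms compact_std_simplex compact_continuous_image compact_imp_bounded by blast
  then show ?thesis
    using that unfolding bounded_pos by auto
qed

lemma abs_le_sup_norm: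
  assumes "continuous_on std_simplex F" "x \<in> std_simplex"
  shows "\<bar>F x\<bar> \<le> sup_norm F"
proof -
  obtain B where "\<And>x. x \<in> std_simplex \<Longrightarrow> \<bar>F x\<bar> \<le> B"
    using continuous_on_std_simplex_bounded[OF assms(1)] by blast
  then show ?thesis
    unfolding sup_norm_def using assms(2) by (intro cSUP_upper bdd_aboveI2)
qed

section \<open>The Bernstein polynomials are a partition of unity\<close>

text \<open>
  The multinomial theorem in the form that an induction on \<open>A\<close> proves directly: dividing by factorials
  turns it into the multiplicativity of the exponential series, so that splitting off one index is just
  the binomial theorem. Multi-indices are made to vanish off \<open>A\<close> so that each is counted once.
\<close>
lemma multinomial_expansion:
  fixes y :: "'a \<Rightarrow> real"
  assumes "finite A"
  shows "(\<Sum>i\<in>A. y i) ^ n / fact n =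
    (\<Sum>\<alpha> | (\<forall>j. j \<notin> A \<longrightarrow> \<alpha> j = 0) \<and> sum \<alpha> A = n. \<Prod>j\<in>A. y j ^ \<alpha> j / fact (\<alpha> j))"
  using assms
proof (induction A arbitrary: n rule: finite_induct)
  case empty
  have "{\<alpha> :: 'a \<Rightarrow> nat. (\<forall>j. \<alpha> j = 0) \<and> 0 = n} = (if n = 0 then {\<lambda>_. 0} else {})"
    by auto
  then show ?case
    by (simp add: power_0_left)
next
  case (insert a A)
  define M where "M B m = {\<alpha> :: 'a \<Rightarrow> nat. (\<forall>j. j \<notin> B \<longrightarrow> \<alpha> j = 0) \<and> sum \<alpha> B = m}" for B m
  define t where "t B \<alpha> = (\<Prod>j\<in>B. y j ^ \<alpha> j / fact (\<alpha> j))" for B and \<alpha> :: "'a \<Rightarrow> nat"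
  have fin: "finite (M A m)" for m
  proof (rule finite_subset)
    show "M A m \<subseteq> {\<alpha>. \<forall>j. (j \<in> A \<longrightarrow> \<alpha> j \<in> {..m}) \<and> (j \<notin> A \<longrightarrow> \<alpha> j = 0)}"
      using insert.hyps(1) by (auto simp: M_def intro: member_le_sum)
    show "finite {\<alpha>. \<forall>j. (j \<in> A \<longrightarrow> \<alpha> j \<in> {..m}) \<and> (j \<notin> A \<longrightarrow> \<alpha> j = 0)}"
      using insert.hyps(1) by (intro finite_set_of_finite_funs) auto
  qed
  have upd: "sum (\<beta>(a := k)) A = sum \<beta> A" "t A (\<beta>(a := k)) = t A \<beta>" for \<beta> and k :: nat
    using insert.hyps(2) by (auto simp: t_def intro!: sum.cong prod.cong)
  have "(\<Sum>i\<in>insert a A. y i) ^ n / fact n = (y a + sum y A) ^ n / fact n"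
    using insert.hyps by simp
  also have "\<dots> = (\<Sum>k\<le>n. (y a ^ k / fact k) * (sum y A ^ (n - k) / fact (n - k)))"
    by (simp add: binomial_ring sum_divide_distrib binomial_fact field_simps)
  also have "\<dots> = (\<Sum>k\<le>n. \<Sum>\<beta>\<in>M A (n - k). (y a ^ k / fact k) * t A \<beta>)"
    by (simp add: insert.IH sum_distrib_left M_def t_def)
  also have "\<dots> = (\<Sum>(k, \<beta>)\<in>Sigma {..n} (\<lambda>k. M A (n - k)). (y a ^ k / fact k) * t A \<beta>)"
    using fin by (simp add: sum.Sigma)
  also have "\<dots> = (\<Sum>\<alpha>\<in>M (insert a A) n. t (insert a A) \<alpha>)"
  proof (rule sum.reindex_bij_witness[where i = "\<lambda>\<alpha>. (\<alpha> a, \<alpha>(a := 0))" and j = "\<lambda>(k, \<beta>). \<beta>(a := k)"],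
      goal_cases)
    case (1 p) then show ?case using insert.hyps by (auto simp: M_def fun_eq_iff)
  next
    case (2 p) then show ?case using insert.hyps by (auto simp: M_def upd[unfolded fun_upd_def])
  next
    case (3 \<alpha>) then show ?case by auto
  next
    case (4 \<alpha>)
    then have "\<alpha>(a := 0) \<in> M A (n - \<alpha> a)" "\<alpha> a \<le> n"
      using insert.hyps by (auto simp: M_def upd simp del: fun_upd_apply) auto
    then show ?case by simp
  next
    case (5 p) then show ?case using insert.hyps upd by (auto simp: t_def)
  qed
  finally show ?case
    by (simp add: M_def t_def)
qed

lemma sum_bern_B_eq_1: "(\<Sum>\<alpha> | mi_size \<alpha> = n. bern_B \<alpha> (x :: real ^ 'd)) = 1"
proof -
  \<comment> \<open>The barycentric coordinates of \<open>x\<close>, which add up to \<open>1\<close>.\<close>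
  define y where "y j = (case j of None \<Rightarrow> 1 - (\<Sum>i\<in>UNIV. x $ i) | Some i \<Rightarrow> x $ i)" for j
  have split: "prod h UNIV = h None * (\<Prod>i\<in>UNIV. h (Some i))" for h :: "'d option \<Rightarrow> real"
    by (simp add: UNIV_option_conv prod.reindex)
  have splits: "sum y UNIV = y None + (\<Sum>i\<in>UNIV. y (Some i))"
    by (simp add: UNIV_option_conv sum.reindex)
  have B: "bern_B \<alpha> x = fact n * (\<Prod>j\<in>UNIV. y j ^ \<alpha> j / fact (\<alpha> j))" if "mi_size \<alpha> = n" for \<alpha>
    using that by (simp add: bern_B_def bern_P_def prod_dividef split y_def)
  have "(\<Sum>\<alpha> | mi_size \<alpha> = n. bern_B \<alpha> x)
      = fact n * (\<Sum>\<alpha> | mi_size \<alpha> = n. \<Prod>j\<in>UNIV. y j ^ \<alpha> j / fact (\<alpha> j))"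
    unfolding sum_distrib_left by (rule sum.cong) (simp_all add: B)
  also have "(\<Sum>\<alpha> | mi_size \<alpha> = n. \<Prod>j\<in>UNIV. y j ^ \<alpha> j / fact (\<alpha> j)) = sum y UNIV ^ n / fact n"
    using multinomial_expansion[of UNIV y n] by (simp add: mi_size_def)
  also have "sum y UNIV = 1"
    unfolding splits by (simp add: y_def)
  finally show ?thesis by simp
qed

section \<open>Level sums of a submodular set function\<close>

text \<open>
  With \<open>X\<^sub>k = {H \<ge> k}\<close>, the level sets of \<open>H + 1\<^sub>A\<close> are \<open>X\<^sub>k\<^sub>+\<^sub>1 \<union> (X\<^sub>k \<inter> A)\<close>, and these two sets meet
  in \<open>X\<^sub>k\<^sub>+\<^sub>1 \<inter> A\<close>. Submodularity therefore bounds the sum by a telescoping one. The induction keeps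
  the last term \<open>\<mu>(X\<^sub>N \<inter> A)\<close> on the left, which avoids subtraction in the extended
  nonnegative reals.
\<close>
lemma submodular_sum_levels_indicator:
  fixes \<mu> :: "'a set \<Rightarrow> ennreal" and H :: "'a \<Rightarrow> nat"
  assumes sub: "\<And>A B. A \<in> sets M \<Longrightarrow> B \<in> sets M \<Longrightarrow> \<mu> (A \<union> B) + \<mu> (A \<inter> B) \<le> \<mu> A + \<mu> B"
    and H [measurable]: "H \<in> measurable M (count_space UNIV)" and A [measurable]: "A \<in> sets M"
  shows "(\<Sum>k<N. \<mu> {\<omega>\<in>space M. Suc k \<le> H \<omega> + of_bool (\<omega> \<in> A)}) \<le> (\<Sum>k<N. \<mu> {\<omega>\<in>space M. Suc k \<le> H \<omega>}) + \<mu> A"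
proof -
  have "(\<Sum>k<N. \<mu> {\<omega>\<in>space M. Suc k \<le> H \<omega> + of_bool (\<omega> \<in> A)}) + \<mu> {\<omega>\<in>A. N \<le> H \<omega>}
      \<le> (\<Sum>k<N. \<mu> {\<omega>\<in>space M. Suc k \<le> H \<omega>}) + \<mu> A"
  proof (induction N)
    case 0
    then show ?case by simp
  next
    case (Suc N)
    have AM: "\<omega> \<in> A \<Longrightarrow> \<omega> \<in> space M" for \<omega>
      using A sets.sets_into_space by blast
    define X where "X = {\<omega>\<in>space M. Suc N \<le> H \<omega>}"
    define Y where "Y = {\<omega>\<in>A. N \<le> H \<omega>}"
    have "Y = A \<inter> {\<omega>\<in>space M. N \<le> H \<omega>}"
      using AM by (auto simp: Y_def)
    then have "Y \<in> sets M"
      by simp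
    moreover have "X \<in> sets M"
      unfolding X_def by measurable
    moreover have "X \<union> Y = {\<omega>\<in>space M. Suc N \<le> H \<omega> + of_bool (\<omega> \<in> A)}"
      and "X \<inter> Y = {\<omega>\<in>A. Suc N \<le> H \<omega>}"
      using AM by (auto simp: X_def Y_def)
    ultimately have step: "\<mu> {\<omega>\<in>space M. Suc N \<le> H \<omega> + of_bool (\<omega> \<in> A)} + \<mu> {\<omega>\<in>A. Suc N \<le> H \<omega>} \<le> \<mu> X + \<mu> Y"
      using sub by metis
    have "(\<Sum>k<Suc N. \<mu> {\<omega>\<in>space M. Suc k \<le> H \<omega> + of_bool (\<omega> \<in> A)}) + \<mu> {\<omega>\<in>A. Suc N \<le> H \<omega>}
        \<le> (\<Sum>k<N. \<mu> {\<omega>\<in>space M. Suc k \<le> H \<omega> + of_bool (\<omega> \<in> A)}) + (\<mu> X + \<mu> Y)"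
      unfolding sum.lessThan_Suc add.assoc by (intro add_left_mono step)
    also have "\<dots> = ((\<Sum>k<N. \<mu> {\<omega>\<in>space M. Suc k \<le> H \<omega> + of_bool (\<omega> \<in> A)}) + \<mu> Y) + \<mu> X"
      by (simp only: ac_simps)
    also have "\<dots> \<le> ((\<Sum>k<N. \<mu> {\<omega>\<in>space M. Suc k \<le> H \<omega>}) + \<mu> A) + \<mu> X"
      unfolding Y_def by (intro add_right_mono Suc.IH)
    finally show ?case
      by (simp only: X_def sum.lessThan_Suc ac_simps)
  qed
  then show ?thesis
    by (rule order_trans[rotated]) simp
qed

text \<open>
  Adding \<open>G\<close> one level at a time means adding the indicators of \<open>{G \<ge> 1}, {G \<ge> 2}, \<dots>\<close>, each of which
  costs at most its own value. Levels of \<open>G\<close> beyond \<open>N\<close> cannot affect the first \<open>N\<close> levels of the sum.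
\<close>
lemma submodular_sum_levels_add:
  fixes \<mu> :: "'a set \<Rightarrow> ennreal" and F G :: "'a \<Rightarrow> nat"
  assumes sub: "\<And>A B. A \<in> sets M \<Longrightarrow> B \<in> sets M \<Longrightarrow> \<mu> (A \<union> B) + \<mu> (A \<inter> B) \<le> \<mu> A + \<mu> B"
    and F [measurable]: "F \<in> measurable M (count_space UNIV)"
    and G [measurable]: "G \<in> measurable M (count_space UNIV)"
  shows "(\<Sum>k<N. \<mu> {\<omega>\<in>space M. Suc k \<le> F \<omega> + G \<omega>})
    \<le> (\<Sum>k<N. \<mu> {\<omega>\<in>space M. Suc k \<le> F \<omega>}) + (\<Sum>k<N. \<mu> {\<omega>\<in>space M. Suc k \<le> G \<omega>})"
proof -
  have "(\<Sum>k<N. \<mu> {\<omega>\<in>space M. Suc k \<le> F \<omega> + min (G \<omega>) j})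
    \<le> (\<Sum>k<N. \<mu> {\<omega>\<in>space M. Suc k \<le> F \<omega>}) + (\<Sum>k<j. \<mu> {\<omega>\<in>space M. Suc k \<le> G \<omega>})" for j
  proof (induction j)
    case 0
    then show ?case by simp
  next
    case (Suc j)
    have eq: "{\<omega>\<in>space M. Suc k \<le> F \<omega> + min (G \<omega>) (Suc j)}
        = {\<omega>\<in>space M. Suc k \<le> (F \<omega> + min (G \<omega>) j) + of_bool (\<omega> \<in> {\<omega>\<in>space M. Suc j \<le> G \<omega>})}" for k
      by (auto simp: min_def)
    have "(\<Sum>k<N. \<mu> {\<omega>\<in>space M. Suc k \<le> F \<omega> + min (G \<omega>) (Suc j)})
       \<le> (\<Sum>k<N. \<mu> {\<omega>\<in>space M. Suc k \<le> F \<omega> + min (G \<omega>) j}) + \<mu> {\<omega>\<in>space M. Suc j \<le> G \<omega>}"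
      unfolding eq by (rule submodular_sum_levels_indicator[OF sub]; measurable)
    also have "\<dots> \<le> ((\<Sum>k<N. \<mu> {\<omega>\<in>space M. Suc k \<le> F \<omega>}) + (\<Sum>k<j. \<mu> {\<omega>\<in>space M. Suc k \<le> G \<omega>}))
        + \<mu> {\<omega>\<in>space M. Suc j \<le> G \<omega>}"
      by (intro add_right_mono Suc.IH)
    finally show ?case
      by (simp only: sum.lessThan_Suc ac_simps)
  qed
  moreover have "(\<Sum>k<N. \<mu> {\<omega>\<in>space M. Suc k \<le> F \<omega> + G \<omega>})
      = (\<Sum>k<N. \<mu> {\<omega>\<in>space M. Suc k \<le> F \<omega> + min (G \<omega>) N})"
    by (intro sum.cong refl arg_cong[where f = \<mu>]) (auto simp: min_def)
  ultimately show ?thesis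
    by (simp only:)
qed

text \<open>
  On each mesh interval a decreasing function lies between its values at the two ends. These Riemann
  sums link the integral over levels to the discrete level sums above.
\<close>
lemma nn_integral_antimono_step_bounds:
  fixes m :: "real \<Rightarrow> ennreal"
  assumes [measurable]: "m \<in> borel_measurable borel" and anti: "antimono m" and e: "0 < e"
  shows "ennreal e * (\<Sum>k<N. m (real (Suc k) * e)) \<le> (\<integral>\<^sup>+\<beta>\<in>{0..<real N * e}. m \<beta> \<partial>lborel)"
    and "(\<integral>\<^sup>+\<beta>\<in>{0..<real N * e}. m \<beta> \<partial>lborel) \<le> ennreal e * (\<Sum>k<N. m (real k * e))"
proof -
  have split: "(\<integral>\<^sup>+\<beta>\<in>{0..<real (Suc N) * e}. m \<beta> \<partial>lborel)
      = (\<integral>\<^sup>+\<beta>\<in>{0..<real N * e}. m \<beta> \<partial>lborel) + (\<integral>\<^sup>+\<beta>\<in>{real N * e..<real (Suc N) * e}. m \<beta> \<partial>lborel)" for N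
  proof -
    have "{0..<real (Suc N) * e} = {0..<real N * e} \<union> {real N * e..<real (Suc N) * e}"
      using e by (intro ivl_disj_un(17)[symmetric]) auto
    then show ?thesis
      by (simp only:) (rule nn_integral_disjoint_pair, auto)
  qed
  have const: "(\<integral>\<^sup>+\<beta>\<in>{real N * e..<real (Suc N) * e}. c \<partial>lborel) = ennreal e * c" for N c
    using e by (simp add: nn_integral_cmult_indicator distrib_right)
        (simp add: mult.commute)
  show "ennreal e * (\<Sum>k<N. m (real (Suc k) * e)) \<le> (\<integral>\<^sup>+\<beta>\<in>{0..<real N * e}. m \<beta> \<partial>lborel)"
  proof (induction N)
    case (Suc N)
    have "(\<integral>\<^sup>+\<beta>\<in>{real N * e..<real (Suc N) * e}. m (real (Suc N) * e) \<partial>lborel)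
        \<le> (\<integral>\<^sup>+\<beta>\<in>{real N * e..<real (Suc N) * e}. m \<beta> \<partial>lborel)"
      by (intro nn_integral_mono) (auto split: split_indicator intro!: antimonoD[OF anti])
    with Suc.IH show ?case
      unfolding split by (simp add: distrib_left const add_mono del: of_nat_Suc)
  qed simp
  show "(\<integral>\<^sup>+\<beta>\<in>{0..<real N * e}. m \<beta> \<partial>lborel) \<le> ennreal e * (\<Sum>k<N. m (real k * e))"
  proof (induction N)
    case (Suc N)
    have "(\<integral>\<^sup>+\<beta>\<in>{real N * e..<real (Suc N) * e}. m \<beta> \<partial>lborel)
       \<le> (\<integral>\<^sup>+\<beta>\<in>{real N * e..<real (Suc N) * e}. m (real N * e) \<partial>lborel)"
      by (intro nn_integral_mono) (auto split: split_indicator intro!: antimonoD[OF anti])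
    with Suc.IH show ?case
      unfolding split by (simp add: distrib_left const add_mono del: of_nat_Suc)
  qed simp
qed

section \<open>The Choquet integral of a submodular set function\<close>

lemma C_plus_measurable:
  assumes "f \<in> C_plus"
  shows "f \<in> borel_measurable (restrict_space borel std_simplex)"
  using assms by (auto simp: C_plus_def intro: borel_measurable_continuous_on_restrict)

lemma C_plus_superlevel:
  assumes "f \<in> C_plus"
  shows "{\<omega>\<in>std_simplex. \<beta> \<le> f \<omega>} \<in> simplex_borel"
proof -
  have "{\<omega>\<in>space (restrict_space borel std_simplex). \<beta> \<le> f \<omega>} \<in> sets (restrict_space borel std_simplex)"
    using C_plus_measurable[OF assms] by measurable
  then show ?thesis
    by (simp add: simplex_borel_def space_restrict_space)
qed

lemma std_simplex_in_simplex_borel: "std_simplex \<in> simplex_borel"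
  using C_plus_superlevel[OF C_plus_const[of 0], of 0] by simp

locale bounded_capacity =
  fixes \<mu> :: "(real ^ 'd) set \<Rightarrow> ennreal"
  assumes bounded: "bounded_sf \<mu>"
    and monotone: "monotone_sf \<mu>"
    and submodular: "submodular_sf \<mu>"
    and strictly_positive: "strictly_positive_sf \<mu>"
begin

lemma capacity_mono: "A \<in> simplex_borel \<Longrightarrow> B \<in> simplex_borel \<Longrightarrow> A \<subseteq> B \<Longrightarrow> \<mu> A \<le> \<mu> B"
  using monotone by (auto simp: monotone_sf_def mono_on_def)

lemma capacity_empty: "\<mu> {} = 0"
  using monotone by (simp add: monotone_sf_def)

lemma capacity_total: "\<mu> std_simplex < \<infinity>"
  using bounded by (simp add: bounded_sf_def)

lemma superlevel_antimono:
  assumes "f \<in> C_plus"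
  shows "antimono (\<lambda>\<beta>. \<mu> {\<omega>\<in>std_simplex. \<beta> \<le> f \<omega>})"
  by (intro antimonoI capacity_mono C_plus_superlevel assms) auto

text \<open>
  A monotone real function is Borel; finiteness of the values allows the passage to real numbers and
  the sign turns antitone into monotone.
\<close>
lemma superlevel_measurable:
  assumes "f \<in> C_plus"
  shows "(\<lambda>\<beta>. \<mu> {\<omega>\<in>std_simplex. \<beta> \<le> f \<omega>}) \<in> borel_measurable borel"
proof -
  define m where "m \<beta> = \<mu> {\<omega>\<in>std_simplex. \<beta> \<le> f \<omega>}" for \<beta>
  have fin: "m \<beta> < \<infinity>" for \<beta>
    unfolding m_def
    by (rule order_le_less_trans[OF capacity_mono capacity_total])
      (auto intro: C_plus_superlevel assms std_simplex_in_simplex_borel)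
  have "mono (\<lambda>\<beta>. - enn2real (m \<beta>))"
    using antimonoD[OF superlevel_antimono[OF assms], folded m_def] fin
    by (intro monoI) (simp add: enn2real_mono)
  then have "(\<lambda>\<beta>. - (- enn2real (m \<beta>))) \<in> borel_measurable borel"
    by (intro borel_measurable_uminus borel_measurable_mono)
  then have "(\<lambda>\<beta>. ennreal (enn2real (m \<beta>))) \<in> borel_measurable borel"
    by simp
  also have "(\<lambda>\<beta>. ennreal (enn2real (m \<beta>))) = m"
    using fin by auto
  finally show ?thesis
    by (simp add: m_def[abs_def])
qed

lemma choquet_integral_mono:
  assumes "f \<in> C_plus" "g \<in> C_plus" "\<And>t. t \<in> std_simplex \<Longrightarrow> f t \<le> g t"
  shows "choquet_integral \<mu> f \<le> choquet_integral \<mu> g"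
proof -
  have "{\<omega>\<in>std_simplex. \<beta> \<le> f \<omega>} \<subseteq> {\<omega>\<in>std_simplex. \<beta> \<le> g \<omega>}" for \<beta>
    using assms(3) by (blast intro: order_trans)
  then show ?thesis
    unfolding choquet_integral_def
    by (intro nn_integral_mono mult_right_mono capacity_mono C_plus_superlevel assms(1,2)) auto
qed

text \<open>
  Levels above a strict bound of \<open>f\<close> are empty, so the integral runs over a bounded interval and can be
  compared with finite sums.
\<close>
lemma choquet_integral_truncate:
  assumes "\<And>t. t \<in> std_simplex \<Longrightarrow> f t < B"
  shows "choquet_integral \<mu> f = (\<integral>\<^sup>+\<beta>\<in>{0..<B}. \<mu> {\<omega>\<in>std_simplex. \<beta> \<le> f \<omega>} \<partial>lborel)"
  unfolding choquet_integral_def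
proof (rule nn_integral_cong)
  fix \<beta> :: real
  have "{\<omega>\<in>std_simplex. \<beta> \<le> f \<omega>} = {}" if "B \<le> \<beta>"
    using that assms by fastforce
  then show "\<mu> {\<omega>\<in>std_simplex. \<beta> \<le> f \<omega>} * indicator {0..} \<beta> = \<mu> {\<omega>\<in>std_simplex. \<beta> \<le> f \<omega>} * indicator {0..<B} \<beta>"
    by (cases "B \<le> \<beta>") (simp_all only: capacity_empty, simp_all add: indicator_def)
qed

lemma choquet_integral_finite:
  assumes f: "f \<in> C_plus"
  shows "choquet_integral \<mu> f < \<infinity>"
proof -
  obtain B where B: "0 < B" "\<And>t. t \<in> std_simplex \<Longrightarrow> \<bar>f t\<bar> \<le> B"
    using continuous_on_std_simplex_bounded f unfolding C_plus_def by blast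
  have "f t < B + 1" if "t \<in> std_simplex" for t
    using B(2)[OF that] by linarith
  then have "choquet_integral \<mu> f = (\<integral>\<^sup>+\<beta>\<in>{0..<B + 1}. \<mu> {\<omega>\<in>std_simplex. \<beta> \<le> f \<omega>} \<partial>lborel)"
    by (rule choquet_integral_truncate)
  also have "\<dots> \<le> (\<integral>\<^sup>+\<beta>\<in>{0..<B + 1}. \<mu> std_simplex \<partial>lborel)"
    by (intro nn_integral_mono mult_right_mono capacity_mono C_plus_superlevel f
        std_simplex_in_simplex_borel) auto
  also have "\<dots> = \<mu> std_simplex * ennreal (B + 1)"
    using B(1) by (simp add: nn_integral_cmult_indicator)
  also have "\<dots> < \<infinity>"
    using capacity_total by (simp add: ennreal_mult_less_top)
  finally show ?thesis .
qed

lemma choquet_integral_zero: "choquet_integral \<mu> (\<lambda>t. 0) = 0"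
proof -
  have "\<mu> {\<omega> \<in> std_simplex. \<beta> \<le> 0} * indicator {0..} \<beta> = \<mu> std_simplex * indicator {0} \<beta>" for \<beta> :: real
    by (auto split: split_indicator simp: capacity_empty)
  then show ?thesis
    by (simp add: choquet_integral_def nn_integral_cmult_indicator del: nn_integral_indicator_singleton)
qed

lemma choquet_integral_cmult:
  assumes f: "f \<in> C_plus" and c: "0 \<le> c"
  shows "choquet_integral \<mu> (\<lambda>t. c * f t) = ennreal c * choquet_integral \<mu> f"
proof (cases "c = 0")
  case True
  then show ?thesis by (simp add: choquet_integral_zero)
next
  case False
  with c have c: "0 < c" by simp
  define m where "m \<beta> = \<mu> {\<omega>\<in>std_simplex. \<beta> \<le> f \<omega>} * indicator {0..} \<beta>" for \<beta> :: real
  have [measurable]: "(\<lambda>\<beta>. \<mu> {\<omega>\<in>std_simplex. \<beta> \<le> c * f \<omega>} * indicator {0..} \<beta>) \<in> borel_measurable borel"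
    using superlevel_measurable[OF C_plus_mult[OF C_plus_const f, of c]] c
    by (intro borel_measurable_times_ennreal) auto
  have "choquet_integral \<mu> (\<lambda>t. c * f t)
      = \<bar>c\<bar> * (\<integral>\<^sup>+\<beta>. \<mu> {\<omega>\<in>std_simplex. 0 + c * \<beta> \<le> c * f \<omega>} * indicator {0..} (0 + c * \<beta>) \<partial>lborel)"
    unfolding choquet_integral_def using c by (intro nn_integral_real_affine) auto
  also have "(\<lambda>\<beta>. \<mu> {\<omega>\<in>std_simplex. 0 + c * \<beta> \<le> c * f \<omega>} * indicator {0..} (0 + c * \<beta>)) = m"
    using c by (auto simp: m_def fun_eq_iff zero_le_mult_iff split: split_indicator)
  finally show ?thesis
    using c by (simp add: choquet_integral_def m_def)
qed

text \<open>
  By continuity \<open>f\<close> exceeds \<open>f p / 2\<close> on a nonempty open set, whose value bounds all levels up to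
  \<open>f p / 2\<close> from below.
\<close>
lemma choquet_integral_pos:
  assumes f: "f \<in> C_plus" and p: "p \<in> interior std_simplex" "0 < f p"
  shows "0 < choquet_integral \<mu> f"
proof -
  define U where "U = interior std_simplex \<inter> f -` {f p / 2<..}"
  have "continuous_on (interior std_simplex) f"
    using f continuous_on_subset[OF _ interior_subset] by (auto simp: C_plus_def)
  then have U: "open U"
    unfolding U_def by (intro continuous_open_preimage) auto
  have "p \<in> U" and sub: "U \<subseteq> std_simplex"
    using p interior_subset by (auto simp: U_def)
  then have pos: "0 < \<mu> U"
    using strictly_positive U by (auto simp: strictly_positive_sf_def Int_absorb2)
  have "U \<in> simplex_borel"
    using U sub by (auto simp: simplex_borel_def sets_restrict_space)
  then have le: "\<mu> U \<le> \<mu> {\<omega>\<in>std_simplex. \<beta> \<le> f \<omega>}" if "\<beta> \<le> f p / 2" for \<beta>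
    using that interior_subset by (intro capacity_mono C_plus_superlevel f) (auto simp: U_def)
  have "0 < \<mu> U * ennreal (f p / 2)"
    using pos p by (simp add: ennreal_zero_less_mult_iff)
  also have "\<dots> = (\<integral>\<^sup>+\<beta>\<in>{0..f p / 2}. \<mu> U \<partial>lborel)"
    using p by (simp add: nn_integral_cmult_indicator)
  also have "\<dots> \<le> choquet_integral \<mu> f"
    unfolding choquet_integral_def using le by (intro nn_integral_mono) (auto split: split_indicator)
  finally show ?thesis .
qed

text \<open>
  The reals are discretised: \<open>F = \<lfloor>f / e\<rfloor>\<close> and \<open>G = \<lfloor>g / e\<rfloor>\<close> have \<open>(f + g) / e < F + G + 2\<close>, so an upper
  Riemann sum for \<open>f + g\<close> is at most a level sum of \<open>F + G\<close> shifted by two levels, while lower Riemann sums for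
  \<open>f\<close> and \<open>g\<close> are exactly the level sums of \<open>F\<close> and \<open>G\<close>. The two lost levels contribute
  \<open>2 e \<mu>(S)\<close>, which vanishes in the limit because \<open>\<mu>\<close> is bounded.
\<close>
lemma choquet_integral_add_le:
  assumes f: "f \<in> C_plus" and g: "g \<in> C_plus"
  shows "choquet_integral \<mu> (\<lambda>t. f t + g t) \<le> choquet_integral \<mu> f + choquet_integral \<mu> g"
proof -
  define m where "m h \<beta> = \<mu> {\<omega>\<in>std_simplex. \<beta> \<le> h \<omega>}" for h :: "real ^ 'd \<Rightarrow> real" and \<beta>
  define M where "M = restrict_space borel (std_simplex :: (real ^ 'd) set)"
  have space: "space M = std_simplex" and sets: "sets M = simplex_borel"
    by (simp_all add: M_def space_restrict_space simplex_borel_def)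
  have fg: "(\<lambda>t. f t + g t) \<in> C_plus"
    using f g by (rule C_plus_add)
  have approx: "choquet_integral \<mu> (\<lambda>t. f t + g t)
      \<le> choquet_integral \<mu> f + choquet_integral \<mu> g + ennreal e * (\<mu> std_simplex + \<mu> std_simplex)"
    if e: "0 < e" for e
  proof -
    define F where "F t = nat \<lfloor>f t / e\<rfloor>" for t
    define G where "G t = nat \<lfloor>g t / e\<rfloor>" for t
    have F: "F \<in> measurable M (count_space UNIV)" and G: "G \<in> measurable M (count_space UNIV)"
      unfolding F_def G_def
      using C_plus_measurable[OF f, folded M_def] C_plus_measurable[OF g, folded M_def] by measurable
    then have FG: "(\<lambda>t. F t + G t) \<in> measurable M (count_space UNIV)"
      by measurable
    have level: "{t \<in> std_simplex. Suc k \<le> nat \<lfloor>h t / e\<rfloor>} = {t \<in> std_simplex. real (Suc k) * e \<le> h t}"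
      for k and h :: "real ^ 'd \<Rightarrow> real"
    proof -
      have "Suc k \<le> nat \<lfloor>y\<rfloor> \<longleftrightarrow> real (Suc k) \<le> y" for y
        by linarith
      then show ?thesis
        using e by (simp only: pos_le_divide_eq)
    qed
    obtain B where B: "\<And>t. t \<in> std_simplex \<Longrightarrow> \<bar>f t + g t\<bar> \<le> B"
      using continuous_on_std_simplex_bounded[of "\<lambda>t. f t + g t"] fg unfolding C_plus_def by blast
    obtain N where "B / e < real N"
      using reals_Archimedean2 by blast
    then have N: "B < real (N + 2) * e"
      using e by (simp add: field_simps)
    \<comment> \<open>From \<open>(f + g) / e < F + G + 2\<close>: two levels are lost by rounding down twice.\<close>
    have shift: "m (\<lambda>t. f t + g t) (real (k + 2) * e) \<le> \<mu> {t \<in> space M. Suc k \<le> F t + G t}" for k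
      unfolding m_def
    proof (intro capacity_mono C_plus_superlevel fg)
      show "{t \<in> space M. Suc k \<le> F t + G t} \<in> simplex_borel"
        using measurable_sets[OF FG, of "{Suc k..}"] by (simp add: sets vimage_def Int_def conj_commute)
      show "{\<omega> \<in> std_simplex. real (k + 2) * e \<le> f \<omega> + g \<omega>} \<subseteq> {t \<in> space M. Suc k \<le> F t + G t}"
      proof
        fix t assume "t \<in> {\<omega> \<in> std_simplex. real (k + 2) * e \<le> f \<omega> + g \<omega>}"
        then have t: "t \<in> std_simplex" "real (k + 2) * e \<le> f t + g t"
          by simp_all
        have "real (k + 2) \<le> f t / e + g t / e"
          using t(2) e by (simp only: pos_le_divide_eq flip: add_divide_distrib)
        moreover have "f t / e < real (F t) + 1" "g t / e < real (G t) + 1"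
          unfolding F_def G_def by linarith+
        ultimately have "real k < real (F t + G t)"
          unfolding of_nat_add by linarith
        then have "k < F t + G t"
          by (simp only: of_nat_less_iff)
        then show "t \<in> {t \<in> space M. Suc k \<le> F t + G t}"
          using t space by (simp only: Suc_le_eq mem_Collect_eq)
      qed
    qed
    have lower: "ennreal e * (\<Sum>k<N. \<mu> {t \<in> space M. Suc k \<le> nat \<lfloor>h t / e\<rfloor>}) \<le> choquet_integral \<mu> h"
      if h: "h \<in> C_plus" for h
    proof -
      have "ennreal e * (\<Sum>k<N. m h (real (Suc k) * e)) \<le> (\<integral>\<^sup>+\<beta>\<in>{0..<real N * e}. m h \<beta> \<partial>lborel)"
        using superlevel_measurable[OF h] superlevel_antimono[OF h] e
        unfolding m_def by (rule nn_integral_antimono_step_bounds(1))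
      also have "\<dots> \<le> choquet_integral \<mu> h"
        unfolding choquet_integral_def m_def by (intro nn_integral_mono) (auto split: split_indicator)
      finally show ?thesis
        by (simp only: m_def space level)
    qed
    have "choquet_integral \<mu> (\<lambda>t. f t + g t)
        = (\<integral>\<^sup>+\<beta>\<in>{0..<real (N + 2) * e}. m (\<lambda>t. f t + g t) \<beta> \<partial>lborel)"
      unfolding m_def using B N by (intro choquet_integral_truncate) (meson abs_ge_self order_le_less_trans)
    also have "\<dots> \<le> ennreal e * (\<Sum>k<N + 2. m (\<lambda>t. f t + g t) (real k * e))"
      using superlevel_measurable[OF fg] superlevel_antimono[OF fg] e
      unfolding m_def by (rule nn_integral_antimono_step_bounds(2))
    also have "(\<Sum>k<N + 2. m (\<lambda>t. f t + g t) (real k * e))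
        = m (\<lambda>t. f t + g t) 0 + m (\<lambda>t. f t + g t) e + (\<Sum>k<N. m (\<lambda>t. f t + g t) (real (k + 2) * e))"
      by (simp add: numeral_2_eq_2 sum.lessThan_Suc_shift add.assoc del: sum.lessThan_Suc)
    also have "\<dots> \<le> \<mu> std_simplex + \<mu> std_simplex + (\<Sum>k<N. \<mu> {t \<in> space M. Suc k \<le> F t + G t})"
      unfolding m_def
      by (intro add_mono sum_mono shift[unfolded m_def] capacity_mono C_plus_superlevel fg std_simplex_in_simplex_borel) auto
    also have "\<dots> \<le> \<mu> std_simplex + \<mu> std_simplex +
        ((\<Sum>k<N. \<mu> {t \<in> space M. Suc k \<le> F t}) + (\<Sum>k<N. \<mu> {t \<in> space M. Suc k \<le> G t}))"
      using submodular unfolding submodular_sf_def sets[symmetric]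
      by (intro add_left_mono submodular_sum_levels_add F G) auto
    finally have "choquet_integral \<mu> (\<lambda>t. f t + g t) \<le> ennreal e * (\<mu> std_simplex + \<mu> std_simplex) +
        (ennreal e * (\<Sum>k<N. \<mu> {t \<in> space M. Suc k \<le> F t}) + ennreal e * (\<Sum>k<N. \<mu> {t \<in> space M. Suc k \<le> G t}))"
      by (simp add: mult_left_mono distrib_left)
    also have "\<dots> \<le> ennreal e * (\<mu> std_simplex + \<mu> std_simplex) + (choquet_integral \<mu> f + choquet_integral \<mu> g)"
      using lower[OF f] lower[OF g] unfolding F_def G_def by (intro add_mono order_refl)
    finally show ?thesis
      by (simp add: add.commute)
  qed
  obtain s where s: "0 \<le> s" "\<mu> std_simplex = ennreal s"
    using capacity_total by (cases "\<mu> std_simplex") auto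
  show ?thesis
  proof (rule ennreal_le_epsilon)
    fix e :: real assume e: "0 < e"
    \<comment> \<open>With mesh \<open>e / (2 s + 1)\<close> the error is below \<open>e\<close>; the \<open>1\<close> keeps the denominator positive.\<close>
    have "ennreal (e / (2 * s + 1)) * (\<mu> std_simplex + \<mu> std_simplex) = ennreal (e / (2 * s + 1) * (s + s))"
      using s e by (simp del: ennreal_plus add: ennreal_plus[symmetric] ennreal_mult[symmetric])
    also have "\<dots> \<le> ennreal e"
      using s e by (intro ennreal_leI) (simp add: field_simps)
    finally show "choquet_integral \<mu> (\<lambda>t. f t + g t) \<le> choquet_integral \<mu> f + choquet_integral \<mu> g + ennreal e"
      using approx[of "e / (2 * s + 1)"] s e
      by (meson add_left_mono add_nonneg_pos divide_pos_pos mult_nonneg_nonneg order_trans zero_le_numeral zero_less_one)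
  qed
qed

end

section \<open>Increments of a function along a segment\<close>

lemma abs_diff_le_modulus_cont:
  assumes f: "continuous_on std_simplex f"
    and "t \<in> std_simplex" "y \<in> std_simplex" "norm (t - y) \<le> \<delta>"
  shows "\<bar>f t - f y\<bar> \<le> modulus_cont f \<delta>"
proof -
  obtain B where B: "\<And>x. x \<in> std_simplex \<Longrightarrow> \<bar>f x\<bar> \<le> B"
    using continuous_on_std_simplex_bounded[OF f] by blast
  have "\<bar>f t - f y\<bar> \<le> 2 * B" if "t \<in> std_simplex" "y \<in> std_simplex" for t y
    using B[OF that(1)] B[OF that(2)] by linarith
  then have "bdd_above {\<bar>f t - f y\<bar> | t y. t \<in> std_simplex \<and> y \<in> std_simplex \<and> norm (t - y) \<le> \<delta>}"
    by (intro bdd_aboveI[of _ "2 * B"]) blast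
  then show ?thesis
    unfolding modulus_cont_def using assms(2-4) by (intro cSup_upper) blast+
qed

lemma abs_diff_le_sum_along_segment:
  fixes f :: "'a::real_vector \<Rightarrow> real"
  assumes "0 < N"
  shows "\<bar>f t - f x\<bar> \<le> (\<Sum>i<N. \<bar>f (x + (real (Suc i) / N) *\<^sub>R (t - x)) - f (x + (real i / N) *\<^sub>R (t - x))\<bar>)"
proof -
  define p where "p i = x + (real i / N) *\<^sub>R (t - x)" for i
  have "f t - f x = (\<Sum>i<N. f (p (Suc i)) - f (p i))"
    unfolding sum_lessThan_telescope[of "\<lambda>i. f (p i)"] using assms by (simp add: p_def)
  then show ?thesis
    using sum_abs[of "\<lambda>i. f (p (Suc i)) - f (p i)" "{..<N}"] by (simp add: p_def)
qed

lemma subdivision_in_convex: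
  fixes S :: "'a::real_vector set"
  assumes "convex S" "x \<in> S" "t \<in> S" "i \<le> N" "0 < N"
  shows "x + (real i / N) *\<^sub>R (t - x) \<in> S"
proof -
  have "(1 - real i / N) *\<^sub>R x + (real i / N) *\<^sub>R t \<in> S"
    using assms by (intro convexD_alt) auto
  then show ?thesis
    by (simp add: algebra_simps)
qed

text \<open>
  The segment from \<open>x\<close> to \<open>t\<close> stays in the simplex by convexity. The number
  \<open>N = \<lfloor>\<parallel>t - x\<parallel> / \<delta>\<rfloor> + 1\<close> of equal pieces is large enough for pieces of length at most \<open>\<delta>\<close> and still at
  most \<open>1 + \<parallel>t - x\<parallel> / \<delta>\<close>.
\<close>
lemma abs_diff_le_scaled_modulus_cont:
  assumes f: "continuous_on std_simplex f"
    and x: "x \<in> std_simplex" and t: "t \<in> std_simplex" and \<delta>: "0 < \<delta>"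
  shows "\<bar>f t - f x\<bar> \<le> (1 + norm (t - x) / \<delta>) * modulus_cont f \<delta>"
proof -
  define N where "N = nat \<lfloor>norm (t - x) / \<delta>\<rfloor> + 1"
  have N: "0 < N" "real N \<le> 1 + norm (t - x) / \<delta>"
    using \<delta> by (auto simp: N_def)
  have "norm (t - x) / \<delta> < real N"
    unfolding N_def by linarith
  then have step: "norm (t - x) / N \<le> \<delta>"
    using \<delta> N(1) by (simp add: field_simps)
  define p where "p i = x + (real i / N) *\<^sub>R (t - x)" for i
  have p: "p i \<in> std_simplex" if "i \<le> N" for i
    unfolding p_def using that N(1) by (intro subdivision_in_convex convex_std_simplex x t)
  have "p (Suc i) - p i = (1 / N) *\<^sub>R (t - x)" for i
    by (simp add: p_def add_divide_distrib algebra_simps)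
  then have "norm (p (Suc i) - p i) \<le> \<delta>" for i
    using step by simp
  then have "\<bar>f (p (Suc i)) - f (p i)\<bar> \<le> modulus_cont f \<delta>" if "i < N" for i
    using that by (intro abs_diff_le_modulus_cont f p) auto
  then have "(\<Sum>i<N. \<bar>f (p (Suc i)) - f (p i)\<bar>) \<le> (\<Sum>i<N. modulus_cont f \<delta>)"
    by (intro sum_mono) simp
  then have "\<bar>f t - f x\<bar> \<le> real N * modulus_cont f \<delta>"
    using abs_diff_le_sum_along_segment[OF N(1), of f t x] by (simp add: p_def)
  also have "0 \<le> modulus_cont f \<delta>"
    using abs_diff_le_modulus_cont[OF f x x, of \<delta>] \<delta> by simp
  then have "real N * modulus_cont f \<delta> \<le> (1 + norm (t - x) / \<delta>) * modulus_cont f \<delta>"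
    using N(2) by (intro mult_right_mono)
  finally show ?thesis .
qed

text \<open>
  Moving from \<open>p\<close> to \<open>q\<close> by changing one coordinate after another never leaves the ball, since every
  intermediate point differs from \<open>p\<close> by at most \<open>\<bar>q $ i - p $ i\<bar>\<close> in each coordinate. Every single move
  is controlled by the one-dimensional mean value inequality, which is all that partial derivatives provide.
\<close>
lemma abs_diff_le_partial_bounds_in_ball:
  fixes g :: "real ^ 'd \<Rightarrow> real"
  assumes deriv: "\<And>i x. x \<in> ball p r \<Longrightarrow> ((\<lambda>h. g (x + h *\<^sub>R axis i 1)) has_real_derivative D i x) (at 0)"
    and bound: "\<And>i x. x \<in> ball p r \<Longrightarrow> \<bar>D i x\<bar> \<le> M i"
    and q: "q \<in> ball p r"
  shows "\<bar>g q - g p\<bar> \<le> (\<Sum>i\<in>UNIV. M i * \<bar>q $ i - p $ i\<bar>)"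
proof -
  define w where "w A = (\<chi> i. if i \<in> A then q $ i else p $ i)" for A
  have "\<bar>g (w A) - g p\<bar> \<le> (\<Sum>i\<in>A. M i * \<bar>q $ i - p $ i\<bar>)" if "finite A" for A
    using that
  proof (induction A rule: finite_induct)
    case empty
    have "w {} = p" by (simp add: w_def)
    then show ?case by simp
  next
    case (insert a A)
    define c where "c = q $ a - p $ a"
    let ?J = "closed_segment 0 c"
    have J: "w A + h *\<^sub>R axis a 1 \<in> ball p r" if "h \<in> ?J" for h
    proof -
      have h: "\<bar>h\<bar> \<le> \<bar>c\<bar>"
        using that by (auto simp: closed_segment_eq_real_ivl split: if_splits)
      have "norm (w A + h *\<^sub>R axis a 1 - p) \<le> norm (q - p)"
        using h insert.hyps by (intro norm_le_componentwise_cart) (auto simp: w_def axis_def c_def)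
      then show ?thesis
        using q by (simp add: dist_norm norm_minus_commute)
    qed
    have "((\<lambda>h. g (w A + h *\<^sub>R axis a 1)) has_real_derivative D a (w A + h *\<^sub>R axis a 1)) (at h within ?J)"
      if "h \<in> ?J" for h
    proof -
      have "((\<lambda>k. g (w A + (k + h) *\<^sub>R axis a 1)) has_real_derivative D a (w A + h *\<^sub>R axis a 1)) (at 0)"
        using deriv[OF J[OF that], of a] by (simp add: algebra_simps)
      then have "((\<lambda>h. g (w A + h *\<^sub>R axis a 1)) has_real_derivative D a (w A + h *\<^sub>R axis a 1)) (at (0 + h))"
        by (simp only: DERIV_shift)
      then show ?thesis
        by (simp add: has_field_derivative_at_within)
    qed
    then have "norm (g (w A + c *\<^sub>R axis a 1) - g (w A + 0 *\<^sub>R axis a 1)) \<le> M a * norm (c - 0)"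
      using bound J by (intro field_differentiable_bound[where S = ?J and f' = "\<lambda>h. D a (w A + h *\<^sub>R axis a 1)"]) auto
    moreover have "w A + c *\<^sub>R axis a 1 = w (insert a A)"
      using insert.hyps by (auto simp: vec_eq_iff w_def axis_def c_def)
    ultimately have "\<bar>g (w (insert a A)) - g (w A)\<bar> \<le> M a * \<bar>q $ a - p $ a\<bar>"
      by (simp add: c_def)
    with insert show ?case
      by simp
  qed
  from this[of UNIV] show ?thesis
    by (simp add: w_def)
qed

text \<open>
  The staircase of the preceding lemma may leave \<open>U\<close> if it is used for \<open>x\<close> and \<open>t\<close> themselves. A compact
  segment in \<open>U\<close> has a uniform neighbourhood in \<open>U\<close>, so after a fine subdivision the staircases between
  consecutive points stay inside, and the bounds add up since consecutive points differ by
  \<open>(t - x) / N\<close>.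
\<close>
lemma abs_diff_le_partial_bounds_in_open_convex:
  fixes g :: "real ^ 'd \<Rightarrow> real"
  assumes U: "open U" "convex U"
    and deriv: "\<And>i x. x \<in> U \<Longrightarrow> ((\<lambda>h. g (x + h *\<^sub>R axis i 1)) has_real_derivative D i x) (at 0)"
    and bound: "\<And>i x. x \<in> U \<Longrightarrow> \<bar>D i x\<bar> \<le> M i"
    and x: "x \<in> U" and t: "t \<in> U"
  shows "\<bar>g t - g x\<bar> \<le> (\<Sum>i\<in>UNIV. M i * \<bar>t $ i - x $ i\<bar>)"
proof -
  have "closed_segment x t \<subseteq> U"
    using U(2) x t by (simp add: closed_segment_subset)
  then obtain \<epsilon> where \<epsilon>: "\<epsilon> > 0" "(\<Union>y\<in>closed_segment x t. ball y \<epsilon>) \<subseteq> U"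
    using compact_subset_open_imp_ball_epsilon_subset[OF compact_segment U(1)] by metis
  obtain N :: nat where "norm (t - x) / \<epsilon> < real N"
    using reals_Archimedean2 by blast
  moreover have "0 \<le> norm (t - x) / \<epsilon>"
    using \<epsilon> by simp
  ultimately have "0 < real N" and "norm (t - x) / \<epsilon> < real N"
    by linarith+
  then have N: "0 < N" "norm (t - x) / N < \<epsilon>"
    using \<epsilon>(1) by (simp_all add: field_simps)
  define p where "p i = x + (real i / N) *\<^sub>R (t - x)" for i
  have diff: "p (Suc i) - p i = (1 / N) *\<^sub>R (t - x)" for i
    by (simp add: p_def add_divide_distrib algebra_simps)
  have step: "\<bar>g (p (Suc i)) - g (p i)\<bar> \<le> (\<Sum>j\<in>UNIV. M j * \<bar>t $ j - x $ j\<bar>) / N" if "i < N" for i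
  proof -
    have "p i \<in> closed_segment x t"
      unfolding p_def using that by (intro subdivision_in_convex convex_closed_segment) auto
    then have sub: "ball (p i) \<epsilon> \<subseteq> U"
      using \<epsilon>(2) by blast
    have "p (Suc i) \<in> ball (p i) \<epsilon>"
      using N(2) by (simp add: dist_norm norm_minus_commute[of "p i"] diff)
    then have le: "\<bar>g (p (Suc i)) - g (p i)\<bar> \<le> (\<Sum>j\<in>UNIV. M j * \<bar>p (Suc i) $ j - p i $ j\<bar>)"
      using sub deriv bound by (intro abs_diff_le_partial_bounds_in_ball[where D = D]) auto
    have "p (Suc i) $ j - p i $ j = (t $ j - x $ j) / N" for j
      using arg_cong[OF diff[of i], of "\<lambda>v. v $ j"] by simp
    with le show ?thesis
      by (simp add: sum_divide_distrib)
  qed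
  have "\<bar>g t - g x\<bar> \<le> (\<Sum>i<N. \<bar>g (p (Suc i)) - g (p i)\<bar>)"
    unfolding p_def using N(1) by (rule abs_diff_le_sum_along_segment)
  also have "\<dots> \<le> (\<Sum>i<N. (\<Sum>j\<in>UNIV. M j * \<bar>t $ j - x $ j\<bar>) / N)"
    using step by (intro sum_mono) simp
  also have "\<dots> = (\<Sum>j\<in>UNIV. M j * \<bar>t $ j - x $ j\<bar>)"
    using N(1) by simp
  finally show ?thesis .
qed

text \<open>
  Partial derivatives are only available in the interior. Both endpoints are pulled towards an interior
  point \<open>c\<close>, which moves them into the interior and shrinks their difference; continuity of
  \<open>g\<close> carries the bound back to the boundary.
\<close>
lemma abs_diff_le_partial_bounds:
  fixes g :: "real ^ 'd \<Rightarrow> real"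
  assumes g: "continuous_on std_simplex g"
    and D: "\<And>i. has_cont_partial i g (D i)"
    and bound: "\<And>i x. x \<in> std_simplex \<Longrightarrow> \<bar>D i x\<bar> \<le> M i"
    and x: "x \<in> std_simplex" and t: "t \<in> std_simplex"
  shows "\<bar>g t - g x\<bar> \<le> (\<Sum>i\<in>UNIV. M i * \<bar>t $ i - x $ i\<bar>)"
proof -
  obtain c :: "real ^ 'd" where c: "c \<in> interior std_simplex"
    using interior_std_simplex_nonempty by blast
  define s where "s n = inverse (real (Suc n))" for n
  define y where "y v n = v - s n *\<^sub>R (v - c)" for v n
  have s: "0 < s n" "s n \<le> 1" for n
    by (auto simp: s_def inverse_le_1_iff)
  have y: "y v n \<in> interior std_simplex" if "v \<in> std_simplex" for v n
    unfolding y_def using s that c by (intro mem_interior_convex_shrink convex_std_simplex)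
  have "\<bar>g (y t n) - g (y x n)\<bar> \<le> (\<Sum>i\<in>UNIV. M i * \<bar>y t n $ i - y x n $ i\<bar>)" for n
    using D bound[OF subsetD[OF interior_subset]] y x t
    by (intro abs_diff_le_partial_bounds_in_open_convex[where U = "interior std_simplex" and D = D])
      (auto simp: has_cont_partial_def convex_std_simplex convex_interior)
  moreover have "(\<Sum>i\<in>UNIV. M i * \<bar>y t n $ i - y x n $ i\<bar>) \<le> (\<Sum>i\<in>UNIV. M i * \<bar>t $ i - x $ i\<bar>)" for n
  proof (intro sum_mono mult_left_mono)
    fix i
    have "y t n $ i - y x n $ i = (1 - s n) * (t $ i - x $ i)"
      by (simp add: y_def algebra_simps)
    then show "\<bar>y t n $ i - y x n $ i\<bar> \<le> \<bar>t $ i - x $ i\<bar>"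
      using s[of n] by (simp add: abs_mult mult_left_le_one_le)
    show "0 \<le> M i"
      using bound[OF x, of i] by linarith
  qed
  ultimately have le: "\<bar>g (y t n) - g (y x n)\<bar> \<le> (\<Sum>i\<in>UNIV. M i * \<bar>t $ i - x $ i\<bar>)" for n
    by (meson order_trans)
  have lim: "(\<lambda>n. g (y v n)) \<longlonglongrightarrow> g v" if "v \<in> std_simplex" for v
  proof -
    have "s \<longlonglongrightarrow> 0"
      unfolding s_def by (rule LIMSEQ_inverse_real_of_nat)
    then have "y v \<longlonglongrightarrow> v - 0 *\<^sub>R (v - c)"
      unfolding y_def by (intro tendsto_intros)
    moreover have "y v n \<in> std_simplex" for n
      using y[OF that] interior_subset by blast
    ultimately show ?thesis
      using g that by (auto simp: continuous_on_sequentially o_def)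
  qed
  have "(\<lambda>n. \<bar>g (y t n) - g (y x n)\<bar>) \<longlonglongrightarrow> \<bar>g t - g x\<bar>"
    using lim x t by (intro tendsto_intros)
  then show ?thesis
    by (rule LIMSEQ_le_const2) (use le in blast)
qed

section \<open>The operator as a sublinear functional\<close>

locale capacity_family =
  fixes n :: nat and \<Gamma> :: "('d::finite option \<Rightarrow> nat) \<Rightarrow> (real ^ 'd) set \<Rightarrow> ennreal"
  assumes capacity: "mi_size \<alpha> = n \<Longrightarrow> bounded_capacity (\<Gamma> \<alpha>)"
begin

abbreviation numer :: "('d option \<Rightarrow> nat) \<Rightarrow> (real ^ 'd \<Rightarrow> real) \<Rightarrow> real" where
  "numer \<alpha> f \<equiv> enn2real (choquet_integral (\<Gamma> \<alpha>) (\<lambda>t. f t * bern_P \<alpha> t))"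

abbreviation denom :: "('d option \<Rightarrow> nat) \<Rightarrow> real" where
  "denom \<alpha> \<equiv> enn2real (choquet_integral (\<Gamma> \<alpha>) (bern_P \<alpha>))"

lemma numer_integrand: "f \<in> C_plus \<Longrightarrow> (\<lambda>t. f t * bern_P \<alpha> t) \<in> C_plus"
  by (intro C_plus_mult bern_P_C_plus)

text \<open>
  Interior points matter because every \<open>P\<^sub>\<alpha>\<close> is positive there, whereas it may vanish on the boundary.
\<close>
lemma numer_pos:
  assumes "mi_size \<alpha> = n" "f \<in> C_plus" "p \<in> interior std_simplex" "0 < f p"
  shows "0 < numer \<alpha> f"
proof -
  interpret bounded_capacity "\<Gamma> \<alpha>" using capacity assms(1) .
  show ?thesis
    using choquet_integral_finite[OF numer_integrand[OF assms(2)]]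
      choquet_integral_pos[OF numer_integrand[OF assms(2)] assms(3) mult_pos_pos[OF assms(4) bern_P_pos[OF assms(3)]]]
    by (simp add: enn2real_positive_iff)
qed

lemma denom_pos: "mi_size \<alpha> = n \<Longrightarrow> 0 < denom \<alpha>"
  using numer_pos[of \<alpha> "\<lambda>t. 1"] interior_std_simplex_nonempty C_plus_const[of 1] by auto

lemma numer_mono:
  assumes "mi_size \<alpha> = n" "f \<in> C_plus" "g \<in> C_plus" "\<And>t. t \<in> std_simplex \<Longrightarrow> f t \<le> g t"
  shows "numer \<alpha> f \<le> numer \<alpha> g"
proof -
  interpret bounded_capacity "\<Gamma> \<alpha>" using capacity assms(1) .
  show ?thesis
    using assms choquet_integral_finite[OF numer_integrand]
    by (intro enn2real_mono choquet_integral_mono numer_integrand)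
      (auto intro: mult_right_mono bern_P_nonneg)
qed

lemma numer_cmult:
  assumes "mi_size \<alpha> = n" "f \<in> C_plus" "0 \<le> c"
  shows "numer \<alpha> (\<lambda>t. c * f t) = c * numer \<alpha> f"
proof -
  interpret bounded_capacity "\<Gamma> \<alpha>" using capacity assms(1) .
  show ?thesis
    using assms choquet_integral_cmult[OF numer_integrand, of f c \<alpha>]
    by (simp add: mult.assoc enn2real_mult)
qed

lemma numer_add_le:
  assumes "mi_size \<alpha> = n" "f \<in> C_plus" "g \<in> C_plus"
  shows "numer \<alpha> (\<lambda>t. f t + g t) \<le> numer \<alpha> f + numer \<alpha> g"
proof -
  interpret bounded_capacity "\<Gamma> \<alpha>" using capacity assms(1) .
  let ?C = "\<lambda>f. choquet_integral (\<Gamma> \<alpha>) (\<lambda>t. f t * bern_P \<alpha> t)"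
  have fin: "?C f < \<infinity>" "?C g < \<infinity>"
    using assms by (intro choquet_integral_finite numer_integrand; simp)+
  have "?C (\<lambda>t. f t + g t) \<le> ?C f + ?C g"
    using choquet_integral_add_le[OF numer_integrand numer_integrand] assms by (simp add: distrib_right)
  then have "enn2real (?C (\<lambda>t. f t + g t)) \<le> enn2real (?C f + ?C g)"
    using fin by (intro enn2real_mono) auto
  then show ?thesis
    using fin by (simp add: enn2real_plus)
qed

lemma BDC_op_nonneg: "x \<in> std_simplex \<Longrightarrow> 0 \<le> BDC_op n \<Gamma> f x"
  unfolding BDC_op_def by (intro sum_nonneg mult_nonneg_nonneg divide_nonneg_nonneg bern_B_nonneg) auto

lemma BDC_op_mono:
  assumes "f \<in> C_plus" "g \<in> C_plus" "\<And>t. t \<in> std_simplex \<Longrightarrow> f t \<le> g t" "x \<in> std_simplex"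
  shows "BDC_op n \<Gamma> f x \<le> BDC_op n \<Gamma> g x"
  unfolding BDC_op_def
  using assms by (intro sum_mono mult_right_mono divide_right_mono numer_mono bern_B_nonneg) auto

lemma BDC_op_cmult:
  assumes "f \<in> C_plus" "0 \<le> c"
  shows "BDC_op n \<Gamma> (\<lambda>t. c * f t) x = c * BDC_op n \<Gamma> f x"
  unfolding BDC_op_def sum_distrib_left
  using assms by (intro sum.cong refl) (simp add: numer_cmult)

lemma BDC_op_add_le:
  assumes "f \<in> C_plus" "g \<in> C_plus" "x \<in> std_simplex"
  shows "BDC_op n \<Gamma> (\<lambda>t. f t + g t) x \<le> BDC_op n \<Gamma> f x + BDC_op n \<Gamma> g x"
  unfolding BDC_op_def sum.distrib[symmetric] distrib_right[symmetric] add_divide_distrib[symmetric]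
  using assms by (intro sum_mono mult_right_mono divide_right_mono numer_add_le bern_B_nonneg) auto

lemma BDC_op_one: "BDC_op n \<Gamma> (\<lambda>t. 1) x = 1"
proof -
  have "BDC_op n \<Gamma> (\<lambda>t. 1) x = (\<Sum>\<alpha> | mi_size \<alpha> = n. bern_B \<alpha> x)"
    unfolding BDC_op_def using denom_pos by (intro sum.cong refl) (simp add: less_imp_neq[symmetric])
  then show ?thesis
    by (simp add: sum_bern_B_eq_1)
qed

lemma BDC_op_const: "0 \<le> c \<Longrightarrow> BDC_op n \<Gamma> (\<lambda>t. c) x = c"
  using BDC_op_cmult[OF C_plus_const[of 1], of c x] by (simp add: BDC_op_one)

lemma BDC_op_sum_le:
  assumes "finite I" "\<And>i. i \<in> I \<Longrightarrow> f i \<in> C_plus" "x \<in> std_simplex"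
  shows "BDC_op n \<Gamma> (\<lambda>t. \<Sum>i\<in>I. f i t) x \<le> (\<Sum>i\<in>I. BDC_op n \<Gamma> (f i) x)"
  using assms
proof (induction I rule: finite_induct)
  case empty
  then show ?case by (simp add: BDC_op_const)
next
  case (insert a I)
  have "BDC_op n \<Gamma> (\<lambda>t. f a t + (\<Sum>i\<in>I. f i t)) x
      \<le> BDC_op n \<Gamma> (f a) x + BDC_op n \<Gamma> (\<lambda>t. \<Sum>i\<in>I. f i t) x"
    using insert.prems by (intro BDC_op_add_le C_plus_sum) auto
  with insert show ?case
    by (fastforce intro: order_trans)
qed

text \<open>
  The values \<open>B\<^sub>\<alpha>(x)\<close> add up to one, so at least one summand has a nonzero factor \<open>B\<^sub>\<alpha>(x)\<close>, also when
  \<open>x\<close> lies on the boundary.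
\<close>
lemma BDC_op_pos:
  assumes x: "x \<in> std_simplex" and f: "f \<in> C_plus" and p: "p \<in> interior std_simplex" "0 < f p"
  shows "0 < BDC_op n \<Gamma> f x"
proof -
  obtain \<alpha> where \<alpha>: "mi_size \<alpha> = n" "bern_B \<alpha> x \<noteq> 0"
    using sum_bern_B_eq_1[of x n] by (metis (mono_tags, lifting) mem_Collect_eq sum.neutral zero_neq_one)
  then have "0 < bern_B \<alpha> x"
    using bern_B_nonneg[OF x, of \<alpha>] by simp
  then show ?thesis
    unfolding BDC_op_def using \<alpha>(1) f p x
    by (intro sum_pos2[OF finite_mi_size, of \<alpha>] mult_pos_pos mult_nonneg_nonneg divide_pos_pos
        divide_nonneg_nonneg numer_pos denom_pos bern_B_nonneg) auto
qed

text \<open>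
  Both \<open>f \<le> c + h\<close> and \<open>c \<le> f + h\<close> are inequalities between nonnegative functions, so monotonicity and
  subadditivity apply to each although the operator need not be additive.
\<close>
lemma BDC_op_deviation_le:
  assumes f: "f \<in> C_plus" and h: "h \<in> C_plus" and c: "0 \<le> c" and x: "x \<in> std_simplex"
    and dev: "\<And>t. t \<in> std_simplex \<Longrightarrow> \<bar>f t - c\<bar> \<le> h t"
  shows "\<bar>BDC_op n \<Gamma> f x - c\<bar> \<le> BDC_op n \<Gamma> h x"
proof -
  have "BDC_op n \<Gamma> f x \<le> BDC_op n \<Gamma> (\<lambda>t. c + h t) x"
    using dev by (intro BDC_op_mono C_plus_add C_plus_const f h c x) (auto dest!: dev)
  also have "\<dots> \<le> c + BDC_op n \<Gamma> h x"
    using BDC_op_add_le[OF C_plus_const h x, OF c] by (simp add: BDC_op_const c)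
  finally have up: "BDC_op n \<Gamma> f x - c \<le> BDC_op n \<Gamma> h x"
    by simp
  have "c \<le> BDC_op n \<Gamma> (\<lambda>t. f t + h t) x"
    using BDC_op_mono[OF C_plus_const[OF c] C_plus_add[OF f h] _ x] dev
    by (force simp: BDC_op_const c)
  also have "\<dots> \<le> BDC_op n \<Gamma> f x + BDC_op n \<Gamma> h x"
    by (intro BDC_op_add_le f h x)
  finally show ?thesis
    using up by linarith
qed

text \<open>
  The choice \<open>\<delta> = T \<phi>\<^sub>x\<close> balances the two terms of \<open>h(t) = \<omega> + (\<omega> / \<delta>) \<phi>\<^sub>x(t)\<close>: each contributes one \<open>\<omega>\<close>
  to \<open>T h\<close>.
\<close>
theorem BDC_op_modulus_estimate:
  assumes f: "f \<in> C_plus" and x: "x \<in> std_simplex"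
  shows "\<bar>BDC_op n \<Gamma> f x - f x\<bar> \<le> 2 * modulus_cont f (BDC_op n \<Gamma> (\<lambda>t. norm (t - x)) x)"
proof -
  define \<delta> where "\<delta> = BDC_op n \<Gamma> (\<lambda>t. norm (t - x)) x"
  define \<omega> where "\<omega> = modulus_cont f \<delta>"
  have cont: "continuous_on std_simplex f"
    using f by (simp add: C_plus_def)
  have \<phi>: "(\<lambda>t. norm (t - x)) \<in> C_plus"
    by (auto simp: C_plus_def intro!: continuous_intros)
  \<comment> \<open>No singleton is open, so \<open>\<phi>\<^sub>x\<close> is positive at some interior point.\<close>
  have "interior std_simplex \<noteq> {x}"
    by (metis open_interior not_open_singleton)
  then obtain p where "p \<in> interior std_simplex" "p \<noteq> x"
    using interior_std_simplex_nonempty by blast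
  then have \<delta>: "0 < \<delta>"
    unfolding \<delta>_def by (intro BDC_op_pos \<phi> x) auto
  have \<omega>: "0 \<le> \<omega>"
    using abs_diff_le_modulus_cont[OF cont x x, of \<delta>] \<delta> by (simp add: \<omega>_def)
  have h: "(\<lambda>t. \<omega> / \<delta> * norm (t - x)) \<in> C_plus"
    using \<omega> \<delta> by (intro C_plus_mult[OF C_plus_const \<phi>]) simp
  have "\<bar>BDC_op n \<Gamma> f x - f x\<bar> \<le> BDC_op n \<Gamma> (\<lambda>t. \<omega> + \<omega> / \<delta> * norm (t - x)) x"
  proof (rule BDC_op_deviation_le)
    show "\<bar>f t - f x\<bar> \<le> \<omega> + \<omega> / \<delta> * norm (t - x)" if "t \<in> std_simplex" for t
      using abs_diff_le_scaled_modulus_cont[OF cont x that \<delta>] by (simp add: \<omega>_def algebra_simps)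
    show "0 \<le> f x"
      using f x by (simp add: C_plus_def)
  qed (intro f x C_plus_add C_plus_const \<omega> h)+
  also have "\<dots> \<le> \<omega> + \<omega> / \<delta> * \<delta>"
    using BDC_op_add_le[OF C_plus_const[OF \<omega>] h x] \<omega> \<delta> BDC_op_cmult[OF \<phi>, of "\<omega> / \<delta>" x]
    by (simp add: BDC_op_const \<delta>_def)
  also have "\<dots> = 2 * \<omega>"
    using \<delta> by simp
  finally show ?thesis
    by (simp add: \<omega>_def \<delta>_def)
qed

text \<open>
  A supremum of reals bounds its values only for bounded sets; here \<open>\<bar>t $ i - x $ i\<bar> \<le> 1\<close> on the simplex
  bounds the operator by its value \<open>1\<close> at the constant function.
\<close>
lemma BDC_op_abs_coord_le_sup_norm:
  assumes x: "x \<in> std_simplex"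
  shows "BDC_op n \<Gamma> (\<lambda>t. \<bar>t $ i - x $ i\<bar>) x \<le> sup_norm (\<lambda>x. BDC_op n \<Gamma> (\<lambda>t. \<bar>t $ i - x $ i\<bar>) x)"
proof -
  have "\<bar>BDC_op n \<Gamma> (\<lambda>t. \<bar>t $ i - x $ i\<bar>) x\<bar> \<le> 1" if x: "x \<in> std_simplex" for x
  proof -
    have "\<bar>t $ i - x $ i\<bar> \<le> 1" if "t \<in> std_simplex" for t
    proof -
      have "0 \<le> t $ i" "t $ i \<le> 1" "0 \<le> x $ i" "x $ i \<le> 1"
        using that x by (simp_all add: std_simplex_def)
      then show ?thesis
        by linarith
    qed
    then have "BDC_op n \<Gamma> (\<lambda>t. \<bar>t $ i - x $ i\<bar>) x \<le> BDC_op n \<Gamma> (\<lambda>t. 1) x"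
      by (intro BDC_op_mono x) (auto simp: C_plus_def intro!: continuous_intros)
    then show ?thesis
      using BDC_op_nonneg[OF x] by (simp add: BDC_op_one)
  qed
  then have "bdd_above ((\<lambda>x. \<bar>BDC_op n \<Gamma> (\<lambda>t. \<bar>t $ i - x $ i\<bar>) x\<bar>) ` std_simplex)"
    by (intro bdd_aboveI2)
  from cSUP_upper[OF x this] show ?thesis
    by (simp add: sup_norm_def)
qed

text \<open>
  The error splits into \<open>f(t) - g(t)\<close>, \<open>g(t) - g(x)\<close> and \<open>g(x) - f(x)\<close>; the outer two are at most
  \<open>\<parallel>f - g\<parallel>\<close> each, and the middle one is the coordinatewise mean value bound.
\<close>
lemma BDC_op_C1_estimate:
  assumes f: "f \<in> C_plus" and g: "g \<in> C1_plus" and x: "x \<in> std_simplex"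
  shows "\<bar>BDC_op n \<Gamma> f x - f x\<bar> \<le> 2 * sup_norm (\<lambda>x. f x - g x)
    + (\<Sum>i\<in>UNIV. sup_norm (\<lambda>x. BDC_op n \<Gamma> (\<lambda>t. \<bar>t $ i - x $ i\<bar>) x)) * grad_norm g"
proof -
  define e where "e = sup_norm (\<lambda>x. f x - g x)"
  define G where "G = grad_norm g"
  define \<Delta> where "\<Delta> = (\<Sum>i\<in>UNIV. sup_norm (\<lambda>x. BDC_op n \<Gamma> (\<lambda>t. \<bar>t $ i - x $ i\<bar>) x))"
  have cont: "continuous_on std_simplex f" "continuous_on std_simplex g"
    using f g by (auto simp: C1_plus_def C_plus_def)
  have fg: "\<bar>f t - g t\<bar> \<le> e" if "t \<in> std_simplex" for t
    unfolding e_def using abs_le_sup_norm[of "\<lambda>x. f x - g x" t] cont that by (auto intro: continuous_intros)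
  have part: "has_cont_partial i g (partial i g)" for i
    using g someI_ex[of "has_cont_partial i g"] by (simp add: C1_plus_def partial_def)
  have G: "\<bar>partial i g t\<bar> \<le> G" if "t \<in> std_simplex" for i t
  proof -
    have "\<bar>partial i g t\<bar> \<le> sup_norm (partial i g)"
      using part[of i] that by (intro abs_le_sup_norm) (auto simp: has_cont_partial_def)
    also have "\<dots> \<le> G"
      unfolding G_def grad_norm_def by (intro Max_ge) auto
    finally show ?thesis .
  qed
  have nonneg: "0 \<le> e" "0 \<le> G"
    using fg[OF x] G[OF x] abs_ge_zero order_trans by blast+
  have coord: "(\<lambda>t. \<bar>t $ i - x $ i\<bar>) \<in> C_plus" for i
    by (auto simp: C_plus_def intro!: continuous_intros)
  have coords: "(\<lambda>t. \<Sum>i\<in>UNIV. \<bar>t $ i - x $ i\<bar>) \<in> C_plus"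
    by (intro C_plus_sum coord)
  have h: "(\<lambda>t. G * (\<Sum>i\<in>UNIV. \<bar>t $ i - x $ i\<bar>)) \<in> C_plus"
    by (intro C_plus_mult[OF C_plus_const coords] nonneg)
  have "BDC_op n \<Gamma> (\<lambda>t. \<Sum>i\<in>UNIV. \<bar>t $ i - x $ i\<bar>) x
      \<le> (\<Sum>i\<in>UNIV. BDC_op n \<Gamma> (\<lambda>t. \<bar>t $ i - x $ i\<bar>) x)"
    by (intro BDC_op_sum_le coord x) simp
  also have "\<dots> \<le> \<Delta>"
    unfolding \<Delta>_def by (intro sum_mono BDC_op_abs_coord_le_sup_norm x)
  finally have \<Delta>: "BDC_op n \<Gamma> (\<lambda>t. \<Sum>i\<in>UNIV. \<bar>t $ i - x $ i\<bar>) x \<le> \<Delta>" .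
  have "\<bar>BDC_op n \<Gamma> f x - f x\<bar> \<le> BDC_op n \<Gamma> (\<lambda>t. 2 * e + G * (\<Sum>i\<in>UNIV. \<bar>t $ i - x $ i\<bar>)) x"
  proof (rule BDC_op_deviation_le)
    show "\<bar>f t - f x\<bar> \<le> 2 * e + G * (\<Sum>i\<in>UNIV. \<bar>t $ i - x $ i\<bar>)" if t: "t \<in> std_simplex" for t
      using abs_diff_le_partial_bounds[OF cont(2) part G x t] fg[OF t] fg[OF x]
      by (simp add: sum_distrib_left)
    show "0 \<le> f x"
      using f x by (simp add: C_plus_def)
    show "(\<lambda>t. 2 * e + G * (\<Sum>i\<in>UNIV. \<bar>t $ i - x $ i\<bar>)) \<in> C_plus"
      using nonneg by (intro C_plus_add C_plus_const h) simp
  qed (fact f x)+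
  also have "\<dots> \<le> 2 * e + G * BDC_op n \<Gamma> (\<lambda>t. \<Sum>i\<in>UNIV. \<bar>t $ i - x $ i\<bar>) x"
    using BDC_op_add_le[OF C_plus_const h x, of "2 * e"] nonneg BDC_op_cmult[OF coords, of G x]
    by (simp add: BDC_op_const)
  also have "\<dots> \<le> 2 * e + G * \<Delta>"
    using nonneg \<Delta> by (intro add_left_mono mult_left_mono)
  finally show ?thesis
    by (simp only: e_def G_def \<Delta>_def mult.commute)
qed

theorem BDC_op_K_functional_estimate:
  assumes f: "f \<in> C_plus"
  shows "sup_norm (\<lambda>x. BDC_op n \<Gamma> f x - f x) \<le> 2 * K_functional f
    ((\<Sum>i\<in>UNIV. sup_norm (\<lambda>x. BDC_op n \<Gamma> (\<lambda>t. \<bar>t $ i - x $ i\<bar>) x)) / 2)"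
proof -
  define \<Delta> where "\<Delta> = (\<Sum>i\<in>UNIV. sup_norm (\<lambda>x. BDC_op n \<Gamma> (\<lambda>t. \<bar>t $ i - x $ i\<bar>) x))"
  define N where "N = sup_norm (\<lambda>x. BDC_op n \<Gamma> f x - f x)"
  \<comment> \<open>The infimum in \<open>K\<close> is over a nonempty set: it contains the zero function.\<close>
  have "has_cont_partial i (\<lambda>_. 0 :: real) (\<lambda>_. 0)" for i :: 'd
    by (simp add: has_cont_partial_def)
  then have ne: "(C1_plus :: (real ^ 'd \<Rightarrow> real) set) \<noteq> {}"
    using C_plus_const[of 0] by (auto simp: C1_plus_def)
  have "N / 2 \<le> sup_norm (\<lambda>x. f x - g x) + \<Delta> / 2 * grad_norm g" if "g \<in> C1_plus" for g
  proof -
    have "(std_simplex :: (real ^ 'd) set) \<noteq> {}"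
      using interior_std_simplex_nonempty interior_subset by blast
    then have "N \<le> 2 * sup_norm (\<lambda>x. f x - g x) + \<Delta> * grad_norm g"
      unfolding N_def \<Delta>_def sup_norm_def[of "\<lambda>x. BDC_op n \<Gamma> f x - f x"]
      by (rule cSUP_least) (rule BDC_op_C1_estimate[OF f that])
    then show ?thesis by simp
  qed
  then have "N / 2 \<le> K_functional f (\<Delta> / 2)"
    unfolding K_functional_def by (intro cINF_greatest ne)
  then show ?thesis
    by (simp add: N_def \<Delta>_def)
qed

end

section \<open>The two estimates for families of set functions\<close>

text \<open>
  The hypotheses see a set function only on the Borel subsets of the simplex, so they pass from
  the members of the given family at one point \<open>x\<close> to those of the family not depending on \<open>x\<close>.
\<close>
lemma bounded_capacity_cong:
  fixes \<mu> \<nu> :: "(real ^ 'd) set \<Rightarrow> ennreal"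
  assumes "bounded_capacity \<mu>" and eq: "\<And>A. A \<in> simplex_borel \<Longrightarrow> \<mu> A = \<nu> A"
  shows "bounded_capacity \<nu>"
proof -
  interpret bounded_capacity \<mu> by fact
  have rel_open: "A \<inter> std_simplex \<in> simplex_borel" if "open A" for A :: "(real ^ 'd) set"
    using that by (auto simp: simplex_borel_def sets_restrict_space)
  show ?thesis
  proof
    show "bounded_sf \<nu>"
      using bounded eq[OF std_simplex_in_simplex_borel] by (simp add: bounded_sf_def)
    show "monotone_sf \<nu>"
      using capacity_empty eq[of "{}"] capacity_mono eq
      by (auto simp: monotone_sf_def simplex_borel_def intro!: mono_onI)
    show "submodular_sf \<nu>"
      unfolding submodular_sf_def
    proof (intro ballI)
      fix A B :: "(real ^ 'd) set" assume AB: "A \<in> simplex_borel" "B \<in> simplex_borel"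
      then have "A \<union> B \<in> simplex_borel" "A \<inter> B \<in> simplex_borel"
        by (auto simp: simplex_borel_def)
      then show "\<nu> (A \<union> B) + \<nu> (A \<inter> B) \<le> \<nu> A + \<nu> B"
        using submodular AB eq by (metis submodular_sf_def)
    qed
    show "strictly_positive_sf \<nu>"
      using strictly_positive eq[OF rel_open] by (simp add: strictly_positive_sf_def)
  qed
qed

theorem theorem3p1:
  fixes \<Gamma> :: "nat \<Rightarrow> real ^ 'd \<Rightarrow> ('d::finite option \<Rightarrow> nat) \<Rightarrow> (real ^ 'd) set \<Rightarrow> ennreal"
  assumes "\<And>n x \<alpha>. x \<in> std_simplex \<Longrightarrow> mi_size \<alpha> = n \<Longrightarrow>
      bounded_sf (\<Gamma> n x \<alpha>) \<and> monotone_sf (\<Gamma> n x \<alpha>) \<and>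
      submodular_sf (\<Gamma> n x \<alpha>) \<and> strictly_positive_sf (\<Gamma> n x \<alpha>)"
  shows
    "(\<forall>f\<in>C_plus. \<forall>x\<in>std_simplex. \<forall>n.
        \<bar>BDC_op n (\<Gamma> n x) f x - f x\<bar>
          \<le> 2 * modulus_cont f (BDC_op n (\<Gamma> n x) (\<lambda>t. norm (t - x)) x)) \<and>
     (\<forall>\<Gamma>' :: nat \<Rightarrow> ('d option \<Rightarrow> nat) \<Rightarrow> (real ^ 'd) set \<Rightarrow> ennreal.
        (\<forall>n. \<forall>x\<in>std_simplex. \<forall>\<alpha>. mi_size \<alpha> = n \<longrightarrow> (\<forall>A\<in>simplex_borel. \<Gamma> n x \<alpha> A = \<Gamma>' n \<alpha> A)) \<longrightarrow>
        (\<forall>f\<in>C_plus. \<forall>n.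
           sup_norm (\<lambda>x. BDC_op n (\<Gamma>' n) f x - f x)
             \<le> 2 * K_functional f
                 ((\<Sum>i\<in>UNIV. sup_norm (\<lambda>x. BDC_op n (\<Gamma>' n) (\<lambda>t. \<bar>t $ i - x $ i\<bar>) x)) / 2)))"
proof -
  have cap: "bounded_capacity (\<Gamma> n x \<alpha>)" if "x \<in> std_simplex" "mi_size \<alpha> = n" for n x \<alpha>
    using assms[OF that] by (simp add: bounded_capacity_def)
  show ?thesis
  proof (intro conjI ballI allI impI)
    fix f :: "real ^ 'd \<Rightarrow> real" and x :: "real ^ 'd" and n
    assume f: "f \<in> C_plus" and x: "x \<in> std_simplex"
    interpret capacity_family n "\<Gamma> n x"
      by (rule capacity_family.intro) (rule cap[OF x])
    show "\<bar>BDC_op n (\<Gamma> n x) f x - f x\<bar> \<le> 2 * modulus_cont f (BDC_op n (\<Gamma> n x) (\<lambda>t. norm (t - x)) x)"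
      by (rule BDC_op_modulus_estimate[OF f x])
  next
    fix \<Gamma>' :: "nat \<Rightarrow> ('d option \<Rightarrow> nat) \<Rightarrow> (real ^ 'd) set \<Rightarrow> ennreal" and f :: "real ^ 'd \<Rightarrow> real" and n
    assume eq: "\<forall>n. \<forall>x\<in>std_simplex. \<forall>\<alpha>. mi_size \<alpha> = n \<longrightarrow> (\<forall>A\<in>simplex_borel. \<Gamma> n x \<alpha> A = \<Gamma>' n \<alpha> A)"
      and f: "f \<in> C_plus"
    obtain x0 :: "real ^ 'd" where x0: "x0 \<in> std_simplex"
      using interior_std_simplex_nonempty interior_subset by blast
    interpret capacity_family n "\<Gamma>' n"
    proof (rule capacity_family.intro)
      fix \<alpha> :: "'d option \<Rightarrow> nat" assume "mi_size \<alpha> = n"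
      then show "bounded_capacity (\<Gamma>' n \<alpha>)"
        using eq x0 by (intro bounded_capacity_cong[OF cap[OF x0, of \<alpha> n]]) auto
    qed
    show "sup_norm (\<lambda>x. BDC_op n (\<Gamma>' n) f x - f x) \<le> 2 * K_functional f
        ((\<Sum>i\<in>UNIV. sup_norm (\<lambda>x. BDC_op n (\<Gamma>' n) (\<lambda>t. \<bar>t $ i - x $ i\<bar>) x)) / 2)"
      by (rule BDC_op_K_functional_estimate[OF f])
  qed
qed

end
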